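(* Let $W_0:\mathbb{R}^d\times\mathcal{P}_2(\mathbb{R}^d)\to\mathbb{R}^d$ and $F,G:\mathbb{R}^d\times\mathcal{P}_2(\mathbb{R}^d)\times\mathbb{R}^d\to\mathbb{R}^d$ be continuous. Assume: (1) there is a constant $C_1$ with $|W_0(x,\mu)|+|F(x,\mu,u)|+|G(x,\mu,u)|\le C_1(1+|x|+|u|+\sqrt{E_2(\mu)})$ for all $(x,\mu,u)$; (2) there exist $\alpha>0$, $a_0>0$ such that for all $X,Y,U,V\in\mathcal{H}$: $\langle\tilde W_0(X)-\tilde W_0(Y),X-Y\rangle\ge a_0\|\tilde W_0(X)-\tilde W_0(Y)\|^2$; $\langle\tilde G(X,U)-\tilde G(Y,V),X-Y\rangle+\langle\tilde F(X,U)-\tilde F(Y,V),U-V\rangle\ge\alpha\|X-Y\|^2$; (3) there exist $\gamma\in(0,1]$, a constant $C_2$ and a modulus of continuity $\omega$ such that for all $X,Y,U,V\in\mathcal{H}$: $\langle\tilde G(X,U)-\tilde G(Y,V),U-V\rangle\le C_2(\|X-Y\|_\gamma^2+\|U-V\|^2)$; $\langle\tilde F(X,U)-\tilde F(Y,V),X-Y\rangle\ge-C_2(\|X-Y\|_\gamma^2+\|U-V\|_\gamma^2)$; and for all $x,u\in\mathbb{R}^d$, $\mu,\nu\in\mathcal{P}_2(\mathbb{R}^d)$: $|F(x,\mu,u)-F(x,\nu,u)|+|G(x,\mu,u)-G(x,\nu,u)|+|W_0(x,\mu)-W_0(x,\nu)|\le\omega(\mathcal{W}_2(\mu,\nu))$.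 Then there exists a constant $C$ such that, whenever $(X,W^x,Z^x)$ and $(Y,W^y,Z^y)$ are strong solutions on $[0,T]$ of $$X_t=X_0-\int_0^t\tilde F(X_s,W_s)ds+\sigma_xB_t,\qquad W_t=\tilde W_0(X_T)+\int_t^T\tilde G(X_s,W_s)ds-\int_t^TZ_sdB_s$$ with initial data $X_0\in\mathcal{H}$ and $Y_0\in\mathcal{H}$ respectively, $$\sup_{t\in[0,T]}\|W^x_t-W^y_t\|\le C\|X_0-Y_0\|_{\frac{\gamma}{2-\gamma}},\qquad\sup_{t\in[0,T]}\|X_t-Y_t\|\le C\|X_0-Y_0\|_{\frac{\gamma^2}{2-\gamma}}.$$
   Context: Fix $d\ge1$, $T>0$, $\sigma_x\ge0$ and a sufficiently rich probability space. $\mathcal{H}=L^2(\Omega,\mathbb{R}^d)$ with $\langle X,Y\rangle=\mathbb{E}[X\cdot Y]$, norm $\|\cdot\|$; for an exponent $\eta\in(0,1]$, $\|X-Y\|_\eta=\max(\|X-Y\|,\|X-Y\|^\eta)$; $\mathcal{L}(X)$ is the law of $X$; $\mathcal{P}_2(\mathbb{R}^d)$ carries $\mathcal{W}_2$; $E_2(\mu)=\int|y|^2\mu(dy)$. A modulus of continuity is a continuous increasing $\omega:\mathbb{R}^+\to\mathbb{R}^+$ with $\omega(0)=0$. Lifts: $\tilde W_0(X)=W_0(X,\mathcal{L}(X))$, $\tilde F(X,U)=F(X,\mathcal{L}(X),U)$, $\tilde G(X,U)=G(X,\mathcal{L}(X),U)$. $B$ is a $d$-dimensional Brownian motion (the same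 for both solutions) with respect to a filtration for which $X_0,Y_0$ are measurable at time $0$. A strong solution is a triple of adapted, square integrable processes (with $X_t,W_t\in\mathcal{H}$ and $Z$ square integrable with respect to $dt\otimes\mathbb{P}$) satisfying the system. The constant $C$ depends only on the data ($F,G,W_0,T$), not on the solutions. *)

theory Defs
  imports "HOL-Probability.Probability"
begin

section \<open>Square integrable random variables\<close>

text \<open>
  The Hilbert space \<open>L\<^sup>2(\<Omega>; \<real>\<^sup>d)\<close> is represented by functions rather than by classes modulo null
  sets; everything below is insensitive to changes on null sets.
\<close>

definition L2_rv :: "'a measure \<Rightarrow> ('a \<Rightarrow> real^'d) set" where
  "L2_rv M = {X. X \<in> borel_measurable M \<and> integrable M (\<lambda>\<omega>. (norm (X \<omega>))\<^sup>2)}"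

definition L2_inner :: "'a measure \<Rightarrow> ('a \<Rightarrow> real^'d) \<Rightarrow> ('a \<Rightarrow> real^'d) \<Rightarrow> real" where
  "L2_inner M X Y = (\<integral>\<omega>. X \<omega> \<bullet> Y \<omega> \<partial>M)"

definition L2_norm :: "'a measure \<Rightarrow> ('a \<Rightarrow> real^'d) \<Rightarrow> real" where
  "L2_norm M X = sqrt (L2_inner M X X)"

definition L2_norm_exp :: "'a measure \<Rightarrow> real \<Rightarrow> ('a \<Rightarrow> real^'d) \<Rightarrow> real" where
  "L2_norm_exp M \<eta> X = max (L2_norm M X) (L2_norm M X powr \<eta>)"

abbreviation law :: "'a measure \<Rightarrow> ('a \<Rightarrow> real^'d) \<Rightarrow> (real^'d) measure" where
  "law M X \<equiv> distr M borel X"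

text \<open>
  A space that carries one uniform variable carries a random variable of any law on a Polish space;
  in particular a Brownian motion together with an independent initial condition of any law.
\<close>

definition rich_prob_space :: "'a measure \<Rightarrow> bool" where
  "rich_prob_space M \<longleftrightarrow> prob_space M \<and>
     (\<exists>U :: 'a \<Rightarrow> real. U \<in> borel_measurable M \<and>
        distr M lborel U = uniform_measure lborel {0..1})"


section \<open>The Wasserstein space\<close>

definition P2 :: "(real^'d) measure set" where
  "P2 = {\<mu>. prob_space \<mu> \<and> sets \<mu> = sets borel \<and> integrable \<mu> (\<lambda>y. (norm y)\<^sup>2)}"

definition E2 :: "(real^'d) measure \<Rightarrow> real" where
  "E2 \<mu> = (\<integral>y. (norm y)\<^sup>2 \<partial>\<mu>)"

definition couplings :: "(real^'d) measure \<Rightarrow> (real^'d) measure \<Rightarrow> ((real^'d) \<times> (real^'d)) measure set" where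
  "couplings \<mu> \<nu> = {\<pi>. prob_space \<pi> \<and> sets \<pi> = sets (borel \<Otimes>\<^sub>M borel) \<and>
     distr \<pi> borel fst = \<mu> \<and> distr \<pi> borel snd = \<nu>}"

definition W2 :: "(real^'d) measure \<Rightarrow> (real^'d) measure \<Rightarrow> real" where
  "W2 \<mu> \<nu> = sqrt (enn2real (INF \<pi> \<in> couplings \<mu> \<nu>. \<integral>\<^sup>+ (x, y). ennreal ((dist x y)\<^sup>2) \<partial>\<pi>))"

text \<open>Joint continuity on the product of a metric space with \<open>(P2, W2)\<close>.\<close>

definition continuous_P2 ::
  "('x::metric_space \<Rightarrow> (real^'d) measure \<Rightarrow> 'y::metric_space) \<Rightarrow> bool" where
  "continuous_P2 f \<longleftrightarrow>
     (\<forall>x. \<forall>\<mu>\<in>P2. \<forall>\<epsilon>>0. \<exists>\<delta>>0. \<forall>x'. \<forall>\<mu>'\<in>P2.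
        dist x' x < \<delta> \<and> W2 \<mu>' \<mu> < \<delta> \<longrightarrow> dist (f x' \<mu>') (f x \<mu>) < \<epsilon>)"

definition modulus_of_continuity :: "(real \<Rightarrow> real) \<Rightarrow> bool" where
  "modulus_of_continuity w \<longleftrightarrow> continuous_on {0..} w \<and> mono_on {0..} w \<and> w 0 = 0"


section \<open>Lifts to square integrable random variables\<close>

definition lift1 ::
  "'a measure \<Rightarrow> (real^'d \<Rightarrow> (real^'d) measure \<Rightarrow> real^'d) \<Rightarrow> ('a \<Rightarrow> real^'d) \<Rightarrow> 'a \<Rightarrow> real^'d" where
  "lift1 M W0 X = (\<lambda>\<omega>. W0 (X \<omega>) (law M X))"

definition lift2 ::
  "'a measure \<Rightarrow> (real^'d \<Rightarrow> (real^'d) measure \<Rightarrow> real^'d \<Rightarrow> real^'d) \<Rightarrow>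
   ('a \<Rightarrow> real^'d) \<Rightarrow> ('a \<Rightarrow> real^'d) \<Rightarrow> 'a \<Rightarrow> real^'d" where
  "lift2 M F X U = (\<lambda>\<omega>. F (X \<omega>) (law M X) (U \<omega>))"


section \<open>Brownian motion and the Ito integral\<close>

text \<open>
  The library locale \<open>filtration\<close> uses the whole index type; the algebras at negative
  times play no role (a filtration on \<open>[0,\<infinity>)\<close> extends by its value at \<open>0\<close>).
  Neither completeness nor right-continuity is required.
\<close>

definition filtered_space :: "'a measure \<Rightarrow> (real \<Rightarrow> 'a measure) \<Rightarrow> bool" where
  "filtered_space M Ft \<longleftrightarrow> filtration (space M) Ft \<and> (\<forall>t. subalgebra M (Ft t))"

text \<open>
  A standard Brownian motion in dimension \<open>CARD('d)\<close>: the law \<open>N(0, (t - s) I)\<close> of an increment is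
  expressed by independent coordinates with law \<open>N(0, t - s)\<close>.
\<close>

definition brownian_motion ::
  "'a measure \<Rightarrow> (real \<Rightarrow> 'a measure) \<Rightarrow> (real \<Rightarrow> 'a \<Rightarrow> real^'d) \<Rightarrow> bool" where
  "brownian_motion M Ft B \<longleftrightarrow>
     (\<forall>t\<ge>0. B t \<in> borel_measurable (Ft t)) \<and>
     (AE \<omega> in M. B 0 \<omega> = 0) \<and>
     (AE \<omega> in M. continuous_on {0..} (\<lambda>t. B t \<omega>)) \<and>
     (\<forall>s t. 0 \<le> s \<and> s < t \<longrightarrow>
        prob_space.indep_set M (sets (Ft s))
          {(\<lambda>\<omega>. B t \<omega> - B s \<omega>) -` A \<inter> space M | A. A \<in> sets borel} \<and>
        prob_space.indep_vars M (\<lambda>_. borel) (\<lambda>i \<omega>. (B t \<omega> - B s \<omega>) $ i) UNIV \<and>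
        (\<forall>i. distributed M lborel (\<lambda>\<omega>. (B t \<omega> - B s \<omega>) $ i) (normal_density 0 (sqrt (t - s)))))"

definition time_space :: "real \<Rightarrow> real \<Rightarrow> 'a measure \<Rightarrow> (real \<times> 'a) measure" where
  "time_space s t M = restrict_space lborel {s..t} \<Otimes>\<^sub>M M"

text \<open>
  The simple integrand \<open>\<Sum>i<n. 1\<^bsub>(\<tau> i, \<tau> (i+1)]\<^esub> \<xi> i\<close> on \<open>[s,t]\<close>, with matrix-valued bounded
  \<open>\<xi> i\<close> measurable at time \<open>\<tau> i\<close>, and its elementary stochastic integral.
\<close>

definition simple_integrand ::
  "'a measure \<Rightarrow> (real \<Rightarrow> 'a measure) \<Rightarrow> real \<Rightarrow> real \<Rightarrow>
   nat \<Rightarrow> (nat \<Rightarrow> real) \<Rightarrow> (nat \<Rightarrow> 'a \<Rightarrow> real^'d^'d) \<Rightarrow> bool" where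
  "simple_integrand M Ft s t n \<tau> \<xi> \<longleftrightarrow>
     \<tau> 0 = s \<and> \<tau> n = t \<and>
     (\<forall>i<n. \<tau> i \<le> \<tau> (Suc i) \<and> \<xi> i \<in> borel_measurable (Ft (\<tau> i)) \<and> bounded (\<xi> i ` space M))"

definition simple_process ::
  "nat \<Rightarrow> (nat \<Rightarrow> real) \<Rightarrow> (nat \<Rightarrow> 'a \<Rightarrow> real^'d^'d) \<Rightarrow> real \<Rightarrow> 'a \<Rightarrow> real^'d^'d" where
  "simple_process n \<tau> \<xi> r \<omega> = (\<Sum>i<n. indicator {\<tau> i<..\<tau> (Suc i)} r *\<^sub>R \<xi> i \<omega>)"

definition simple_integral ::
  "(real \<Rightarrow> 'a \<Rightarrow> real^'d) \<Rightarrow> nat \<Rightarrow> (nat \<Rightarrow> real) \<Rightarrow> (nat \<Rightarrow> 'a \<Rightarrow> real^'d^'d) \<Rightarrow> 'a \<Rightarrow> real^'d" where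
  "simple_integral B n \<tau> \<xi> \<omega> = (\<Sum>i<n. \<xi> i \<omega> *v (B (\<tau> (Suc i)) \<omega> - B (\<tau> i) \<omega>))"

text \<open>
  \<open>J\<close> is (a version of) the Ito integral of \<open>Z\<close> over \<open>[s,t]\<close>: simple integrands converge to \<open>Z\<close> in
  \<open>L\<^sup>2(dt \<otimes> P)\<close> and their integrals converge to \<open>J\<close> in \<open>L\<^sup>2(P)\<close>. The norm of a matrix is the
  Frobenius norm.
\<close>

definition has_ito_integral ::
  "'a measure \<Rightarrow> (real \<Rightarrow> 'a measure) \<Rightarrow> (real \<Rightarrow> 'a \<Rightarrow> real^'d) \<Rightarrow>
   (real \<Rightarrow> 'a \<Rightarrow> real^'d^'d) \<Rightarrow> real \<Rightarrow> real \<Rightarrow> ('a \<Rightarrow> real^'d) \<Rightarrow> bool" where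
  "has_ito_integral M Ft B Z s t J \<longleftrightarrow>
     J \<in> borel_measurable M \<and>
     (\<exists>n \<tau> \<xi>.
        (\<forall>k::nat. simple_integrand M Ft s t (n k) (\<tau> k) (\<xi> k)) \<and>
        (\<lambda>k. \<integral>\<^sup>+ (r, \<omega>). ennreal ((norm (Z r \<omega> - simple_process (n k) (\<tau> k) (\<xi> k) r \<omega>))\<^sup>2)
               \<partial>time_space s t M) \<longlonglongrightarrow> 0 \<and>
        (\<lambda>k. \<integral>\<^sup>+ \<omega>. ennreal ((norm (J \<omega> - simple_integral B (n k) (\<tau> k) (\<xi> k) \<omega>))\<^sup>2) \<partial>M)
          \<longlonglongrightarrow> 0)"


section \<open>Strong solutions\<close>

definition adapted_L2_process ::
  "'a measure \<Rightarrow> (real \<Rightarrow> 'a measure) \<Rightarrow> real \<Rightarrow> (real \<Rightarrow> 'a \<Rightarrow> 'e::euclidean_space) \<Rightarrow> bool" where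
  "adapted_L2_process M Ft T V \<longleftrightarrow>
     (\<forall>t\<in>{0..T}. V t \<in> borel_measurable (Ft t)) \<and>
     (\<lambda>(t, \<omega>). V t \<omega>) \<in> borel_measurable (time_space 0 T M) \<and>
     integrable (time_space 0 T M) (\<lambda>(t, \<omega>). (norm (V t \<omega>))\<^sup>2)"

text \<open>
  Both equations hold almost surely for each fixed time. The clauses \<open>set_integrable\<close> only say that
  the pathwise time integrals exist.
\<close>

definition strong_solution ::
  "'a measure \<Rightarrow> (real \<Rightarrow> 'a measure) \<Rightarrow> (real \<Rightarrow> 'a \<Rightarrow> real^'d) \<Rightarrow> real \<Rightarrow> real \<Rightarrow>
   (real^'d \<Rightarrow> (real^'d) measure \<Rightarrow> real^'d) \<Rightarrow>
   (real^'d \<Rightarrow> (real^'d) measure \<Rightarrow> real^'d \<Rightarrow> real^'d) \<Rightarrow>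
   (real^'d \<Rightarrow> (real^'d) measure \<Rightarrow> real^'d \<Rightarrow> real^'d) \<Rightarrow>
   ('a \<Rightarrow> real^'d) \<Rightarrow>
   (real \<Rightarrow> 'a \<Rightarrow> real^'d) \<Rightarrow> (real \<Rightarrow> 'a \<Rightarrow> real^'d) \<Rightarrow> (real \<Rightarrow> 'a \<Rightarrow> real^'d^'d) \<Rightarrow> bool" where
  "strong_solution M Ft B T \<sigma> W0 F G X0 X W Z \<longleftrightarrow>
     adapted_L2_process M Ft T X \<and> adapted_L2_process M Ft T W \<and> adapted_L2_process M Ft T Z \<and>
     (\<forall>t\<in>{0..T}. X t \<in> L2_rv M \<and> W t \<in> L2_rv M) \<and>
     (\<forall>t\<in>{0..T}. AE \<omega> in M.
        set_integrable lborel {0..t} (\<lambda>s. lift2 M F (X s) (W s) \<omega>) \<and>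
        X t \<omega> = X0 \<omega> - (LINT s:{0..t}|lborel. lift2 M F (X s) (W s) \<omega>) + \<sigma> *\<^sub>R B t \<omega>) \<and>
     (\<forall>t\<in>{0..T}. \<exists>J. has_ito_integral M Ft B Z t T J \<and>
        (AE \<omega> in M.
           set_integrable lborel {t..T} (\<lambda>s. lift2 M G (X s) (W s) \<omega>) \<and>
           W t \<omega> = lift1 M W0 (X T) \<omega>
             + (LINT s:{t..T}|lborel. lift2 M G (X s) (W s) \<omega>) - J \<omega>))"

end

theory Submission
  imports Defs
begin

text \<open>
  Let \<open>x\<close>, \<open>u\<close>, \<open>f\<close>, \<open>g\<close> be the differences of \<open>X\<close>, \<open>W\<close>, \<open>F\<close>, \<open>G\<close> along the two solutions, \<open>x0\<close> the
  difference of the initial data and \<open>h\<close> that of the terminal conditions. The noise cancels in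
  \<open>x t = x0 - \<integral>\<^sub>0\<^sup>t f\<close>. In the backward equation the stochastic integral is orthogonal to every
  square integrable \<open>\<xi>\<close> that is known at time \<open>t\<close> (\<open>ito_integral_orthogonal\<close>), hence
  \<open>\<langle>\<xi>, u t\<rangle> = \<langle>\<xi>, h\<rangle> + \<integral>\<^sub>t\<^sup>T \<langle>\<xi>, g s\<rangle> ds\<close>. These two relations take the place of the Ito formula: tested
  with \<open>f t\<close>, \<open>g t\<close>, \<open>u t\<close> and \<open>x0\<close> they leave scalar double integrals of kernels such as \<open>\<langle>f r, g s\<rangle>\<close>, and
  Fubini on a triangle yields the three energy relations
  \<open>\<langle>x0, u 0\<rangle> = \<langle>x T, h\<rangle> + \<integral> (\<langle>g,x\<rangle> + \<langle>f,u\<rangle>)\<close> (\<open>duality\<close>),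
  \<open>|u t|\<^sup>2 \<le> |h|\<^sup>2 + 2 \<integral>\<^sub>t\<^sup>T \<langle>g,u\<rangle>\<close> (\<open>backward_energy\<close>) and
  \<open>|x t|\<^sup>2 = |x0|\<^sup>2 - 2 \<integral>\<^sub>0\<^sup>t \<langle>f,x\<rangle>\<close> (\<open>forward_energy\<close>).

  By monotonicity the first relation bounds \<open>a0 |h|\<^sup>2 + \<alpha> A\<close>, with \<open>A = \<integral> |x|\<^sup>2\<close>, by \<open>D = |x0| |u 0|\<close>. Since
  \<open>\<integral> |x|\<^sup>2\<^sup>\<gamma>\<close> is at most a multiple of \<open>A\<^sup>\<gamma>\<close>, the second relation and Gronwall give
  \<open>|u t|\<^sup>2 \<le> K (D + D\<^sup>\<gamma>)\<close> for all \<open>t\<close>. At \<open>t = 0\<close> this is an inequality for \<open>|u 0|\<close> alone. Let \<open>N\<close> be the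
  norm of \<open>x0\<close> with exponent \<open>\<gamma> / (2 - \<gamma>)\<close>; the exponent is such that \<open>|x0|\<^sup>\<gamma> \<le> N\<^sup>2\<^sup>-\<^sup>\<gamma>\<close>, and the inequality
  forces \<open>|u 0|\<close> to be at most a multiple of \<open>N\<close> and \<open>D + D\<^sup>\<gamma>\<close> at most a multiple of \<open>N\<^sup>2\<close> (\<open>absorb_product\<close>).
  This is the first estimate. The third relation then bounds \<open>|x t|\<^sup>2\<close> by a multiple of
  \<open>|x0|\<^sup>2 + N\<^sup>2 + N\<^sup>2\<^sup>\<gamma>\<close>, and \<open>N\<^sup>\<gamma>\<close> is at most the norm with exponent \<open>\<gamma>\<^sup>2 / (2 - \<gamma>)\<close>.

  Exchanging time integrals and expectations requires the coefficients along a solution to be jointly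
  measurable in time and chance. This holds because \<open>s \<mapsto> law (X s)\<close> is continuous for \<open>W2\<close>
  (\<open>solution_law_continuous\<close>), so that \<open>F x (law (X s)) v\<close> is continuous in \<open>(s, x, v)\<close>.
\<close>

section \<open>Square integrable functions\<close>

text \<open>
  One notion serves random variables, paths and processes: the measure is \<open>M\<close>, a time interval, or
  the product of the two.
\<close>

definition square_integrable :: "'b measure \<Rightarrow> ('b \<Rightarrow> 'e::euclidean_space) \<Rightarrow> bool" where
  "square_integrable N X \<longleftrightarrow> X \<in> borel_measurable N \<and> integrable N (\<lambda>z. (norm (X z))\<^sup>2)"

lemma L2_rv_eq: "X \<in> L2_rv M \<longleftrightarrow> square_integrable M X"
  by (simp add: L2_rv_def square_integrable_def)

lemma square_integrableD:
  assumes "square_integrable N X"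
  shows "X \<in> borel_measurable N" "integrable N (\<lambda>z. (norm (X z))\<^sup>2)"
  using assms by (auto simp: square_integrable_def)

lemma square_integrable_bound:
  fixes X :: "'b \<Rightarrow> 'e::euclidean_space"
  assumes "X \<in> borel_measurable N" "integrable N H" "\<And>z. z \<in> space N \<Longrightarrow> (norm (X z))\<^sup>2 \<le> H z"
  shows "square_integrable N X"
proof -
  note [measurable] = assms(1)
  have "integrable N (\<lambda>z. (norm (X z))\<^sup>2)"
  proof (rule Bochner_Integration.integrable_bound[OF assms(2)])
    have "norm ((norm (X z))\<^sup>2) \<le> norm (H z)" if "z \<in> space N" for z
      using assms(3)[OF that] by simp
    then show "AE z in N. norm ((norm (X z))\<^sup>2) \<le> norm (H z)" by (rule AE_I2)
  qed simp
  then show ?thesis by (simp add: square_integrable_def assms(1))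
qed

lemma norm_add_sq_le:
  fixes a b :: "'e::real_inner"
  shows "(norm (a + b))\<^sup>2 \<le> 2 * ((norm a)\<^sup>2 + (norm b)\<^sup>2)"
proof -
  have "0 \<le> (norm (a - b))\<^sup>2" by simp
  then show ?thesis
    unfolding power2_norm_eq_inner
    by (simp add: inner_add_left inner_add_right inner_diff_left inner_diff_right inner_commute)
qed

lemma square_integrable_add:
  fixes X Y :: "'b \<Rightarrow> 'e::euclidean_space"
  assumes X: "square_integrable N X" and Y: "square_integrable N Y"
  shows "square_integrable N (\<lambda>z. X z + Y z)"
proof (rule square_integrable_bound)
  show "integrable N (\<lambda>z. 2 * ((norm (X z))\<^sup>2 + (norm (Y z))\<^sup>2))"
    using square_integrableD(2)[OF X] square_integrableD(2)[OF Y] by simp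
  note [measurable] = square_integrableD(1)[OF X] square_integrableD(1)[OF Y]
  show "(\<lambda>z. X z + Y z) \<in> borel_measurable N" by measurable
qed (rule norm_add_sq_le)

lemma square_integrable_diff:
  fixes X Y :: "'b \<Rightarrow> 'e::euclidean_space"
  assumes X: "square_integrable N X" and Y: "square_integrable N Y"
  shows "square_integrable N (\<lambda>z. X z - Y z)"
  using square_integrable_add[OF X, of "\<lambda>z. - Y z"] Y
  by (simp add: square_integrable_def)

lemma integrable_inner:
  fixes X Y :: "'b \<Rightarrow> 'e::euclidean_space"
  assumes X: "square_integrable N X" and Y: "square_integrable N Y"
  shows "integrable N (\<lambda>z. X z \<bullet> Y z)"
proof (rule Bochner_Integration.integrable_bound)
  note [measurable] = square_integrableD(1)[OF X] square_integrableD(1)[OF Y]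
  show "integrable N (\<lambda>z. (norm (X z))\<^sup>2 + (norm (Y z))\<^sup>2)"
    using X Y by (auto dest: square_integrableD)
  show "(\<lambda>z. X z \<bullet> Y z) \<in> borel_measurable N" by measurable
  have "\<bar>X z \<bullet> Y z\<bar> \<le> (norm (X z))\<^sup>2 + (norm (Y z))\<^sup>2" for z
    using Cauchy_Schwarz_ineq2[of "X z" "Y z"]
      sum_squares_bound[of "norm (X z)" "norm (Y z)"]
      mult_nonneg_nonneg[OF norm_ge_zero[of "X z"] norm_ge_zero[of "Y z"]] by linarith
  then show "AE z in N. norm (X z \<bullet> Y z) \<le> norm ((norm (X z))\<^sup>2 + (norm (Y z))\<^sup>2)" by auto
qed

text \<open>
  The quadratic form \<open>l\<^sup>2 a + 2 l m b + m\<^sup>2 c\<close> of the three integrals is an integral of squares, hence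
  nonnegative. Evaluating it at \<open>(c, -b)\<close> and at \<open>(-b, a)\<close> gives \<open>c (a c - b\<^sup>2) \<ge> 0\<close> and
  \<open>a (a c - b\<^sup>2) \<ge> 0\<close>; only \<open>a = c = 0\<close> needs a separate argument.
\<close>

lemma Cauchy_Schwarz_integral:
  fixes X Y :: "'b \<Rightarrow> 'e::euclidean_space"
  assumes X: "square_integrable N X" and Y: "square_integrable N Y"
  shows "(\<integral>z. X z \<bullet> Y z \<partial>N)\<^sup>2 \<le> (\<integral>z. (norm (X z))\<^sup>2 \<partial>N) * (\<integral>z. (norm (Y z))\<^sup>2 \<partial>N)"
proof -
  define a b c where "a = (\<integral>z. (norm (X z))\<^sup>2 \<partial>N)" and "b = (\<integral>z. X z \<bullet> Y z \<partial>N)"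
    and "c = (\<integral>z. (norm (Y z))\<^sup>2 \<partial>N)"
  note int = integrable_inner[OF X Y] square_integrableD(2)[OF X] square_integrableD(2)[OF Y]
  have q: "0 \<le> l\<^sup>2 * a + 2 * l * m * b + m\<^sup>2 * c" for l m
  proof -
    have "0 \<le> (\<integral>z. (norm (l *\<^sub>R X z + m *\<^sub>R Y z))\<^sup>2 \<partial>N)" by simp
    also have "\<dots> = (\<integral>z. l\<^sup>2 * (norm (X z))\<^sup>2 + 2 * l * m * (X z \<bullet> Y z) + m\<^sup>2 * (norm (Y z))\<^sup>2 \<partial>N)"
      by (intro Bochner_Integration.integral_cong refl)
         (simp only: power2_norm_eq_inner, simp add: inner_add_left inner_add_right inner_commute
           power2_eq_square algebra_simps)
    also have "\<dots> = l\<^sup>2 * a + 2 * l * m * b + m\<^sup>2 * c"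
      using int by (simp add: a_def b_def c_def)
    finally show ?thesis .
  qed
  have "a \<ge> 0" "c \<ge> 0" by (auto simp: a_def c_def)
  have "b\<^sup>2 \<le> a * c"
  proof (cases "a = 0 \<and> c = 0")
    case True
    with q[of 1 "-b"] have "b * b \<le> 0" by simp
    then show ?thesis using True by (simp add: power2_eq_square)
  next
    case False
    have "0 \<le> c * (a * c - b\<^sup>2)" using q[of c "-b"] by (simp add: power2_eq_square algebra_simps)
    moreover have "0 \<le> a * (a * c - b\<^sup>2)"
      using q[of "-b" a] by (simp add: power2_eq_square algebra_simps)
    ultimately show ?thesis using False \<open>a \<ge> 0\<close> \<open>c \<ge> 0\<close>
      by (auto simp: zero_le_mult_iff)
  qed
  then show ?thesis by (simp add: a_def b_def c_def)
qed

lemma norm_set_integral_sq_le: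
  fixes V :: "real \<Rightarrow> 'e::euclidean_space"
  assumes V: "square_integrable N V" and A: "A \<in> sets N" "emeasure N A < \<infinity>"
  shows "(norm (LINT s:A|N. V s))\<^sup>2 \<le> measure N A * (\<integral>s. (norm (V s))\<^sup>2 \<partial>N)"
proof -
  note [measurable] = square_integrableD(1)[OF V] A(1)
  have "norm (LINT s:A|N. V s) \<le> (\<integral>s. norm (indicator A s *\<^sub>R V s) \<partial>N)"
    unfolding set_lebesgue_integral_def by (rule integral_norm_bound)
  also have "\<dots> = (\<integral>s. indicator A s \<bullet> norm (V s) \<partial>N)"
    by (auto intro!: Bochner_Integration.integral_cong simp: indicator_def)
  finally have *: "norm (LINT s:A|N. V s) \<le> (\<integral>s. indicator A s \<bullet> norm (V s) \<partial>N)" .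
  have "(norm (LINT s:A|N. V s))\<^sup>2 \<le> (\<integral>s. indicator A s \<bullet> norm (V s) \<partial>N)\<^sup>2"
    by (rule power_mono[OF *]) simp
  also have "\<dots> \<le> (\<integral>s. (norm (indicator A s :: real))\<^sup>2 \<partial>N) * (\<integral>s. (norm (norm (V s)))\<^sup>2 \<partial>N)"
  proof (rule Cauchy_Schwarz_integral)
    have "(\<lambda>s. (norm (indicator A s :: real))\<^sup>2) = indicator A"
      by (auto simp: indicator_def)
    then show "square_integrable N (indicator A :: _ \<Rightarrow> real)"
      using A by (simp add: square_integrable_def)
    show "square_integrable N (\<lambda>s. norm (V s))"
      using square_integrableD(2)[OF V] by (simp add: square_integrable_def)
  qed
  also have "(\<lambda>s. (norm (indicator A s :: real))\<^sup>2) = indicator A"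
    by (auto simp: indicator_def)
  finally show ?thesis using A by simp
qed

lemma (in finite_measure) integrable_square_integrable:
  fixes V :: "'a \<Rightarrow> 'e::euclidean_space"
  assumes V: "square_integrable M V"
  shows "integrable M V"
proof (rule Bochner_Integration.integrable_bound)
  show "integrable M (\<lambda>z. 1 + (norm (V z))\<^sup>2)" using V by (auto dest: square_integrableD)
  have "norm (V z) \<le> 1 + (norm (V z))\<^sup>2" for z
    using sum_squares_bound[of "norm (V z)" 1] norm_ge_zero[of "V z"]
    by (simp only: power_one mult_1_right)
  then show "AE z in M. norm (V z) \<le> norm (1 + (norm (V z))\<^sup>2)" by auto
qed (use V in \<open>auto dest: square_integrableD\<close>)

lemma square_integrable_linear_growth:
  fixes V :: "'b \<Rightarrow> 'e::euclidean_space" and X U :: "'b \<Rightarrow> 'f::euclidean_space" and m :: "'b \<Rightarrow> real"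
  assumes V: "V \<in> borel_measurable N" and one: "integrable N (\<lambda>_. 1 :: real)"
    and X: "square_integrable N X" and U: "square_integrable N U" and m: "square_integrable N m"
    and bound: "\<And>z. z \<in> space N \<Longrightarrow> norm (V z) \<le> C * (1 + norm (X z) + norm (U z) + m z)"
  shows "square_integrable N V"
proof (rule square_integrable_bound[OF V])
  show "integrable N (\<lambda>z. C\<^sup>2 * (4 * (1 + (norm (X z))\<^sup>2 + (norm (U z))\<^sup>2 + (norm (m z))\<^sup>2)))"
    using one square_integrableD(2)[OF X] square_integrableD(2)[OF U] square_integrableD(2)[OF m]
    by (intro integrable_mult_right Bochner_Integration.integrable_add)
  fix z assume z: "z \<in> space N"
  have "(norm (V z))\<^sup>2 \<le> (C * (1 + norm (X z) + norm (U z) + m z))\<^sup>2"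
    by (rule power_mono[OF bound[OF z]]) simp
  also have "\<dots> = C\<^sup>2 * (1 + norm (X z) + norm (U z) + m z)\<^sup>2" by (rule power_mult_distrib)
  also have "\<dots> \<le> C\<^sup>2 * (4 * (1 + (norm (X z))\<^sup>2 + (norm (U z))\<^sup>2 + (norm (m z))\<^sup>2))"
  proof (rule mult_left_mono)
    have "(a + b + c + d)\<^sup>2 \<le> 4 * (a\<^sup>2 + b\<^sup>2 + c\<^sup>2 + d\<^sup>2)" for a b c d :: real
      using norm_add_sq_le[of "a + b" "c + d"] norm_add_sq_le[of a b] norm_add_sq_le[of c d]
      by (simp add: add.assoc)
    from this[of 1 "norm (X z)" "norm (U z)" "m z"]
    show "(1 + norm (X z) + norm (U z) + m z)\<^sup>2
        \<le> 4 * (1 + (norm (X z))\<^sup>2 + (norm (U z))\<^sup>2 + (norm (m z))\<^sup>2)" by simp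
  qed simp
  finally show "(norm (V z))\<^sup>2 \<le> C\<^sup>2 * (4 * (1 + (norm (X z))\<^sup>2 + (norm (U z))\<^sup>2 + (norm (m z))\<^sup>2))" .
qed

section \<open>The inner product of \<open>L\<^sup>2\<close>\<close>

lemma L2_norm_sq: "(L2_norm M X)\<^sup>2 = L2_inner M X X"
  by (simp add: L2_norm_def L2_inner_def)

lemma L2_norm_sq_integral: "(L2_norm M X)\<^sup>2 = (\<integral>\<omega>. (norm (X \<omega>))\<^sup>2 \<partial>M)"
  by (simp add: L2_norm_sq L2_inner_def power2_norm_eq_inner)

lemma L2_norm_nonneg [simp]: "0 \<le> L2_norm M X"
  by (simp add: L2_norm_def L2_inner_def)

lemma L2_rv_diff: "X \<in> L2_rv M \<Longrightarrow> Y \<in> L2_rv M \<Longrightarrow> X - Y \<in> L2_rv M"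
  unfolding L2_rv_eq fun_diff_def by (rule square_integrable_diff)

lemma L2_rv_add: "X \<in> L2_rv M \<Longrightarrow> Y \<in> L2_rv M \<Longrightarrow> (\<lambda>\<omega>. X \<omega> + Y \<omega>) \<in> L2_rv M"
  unfolding L2_rv_eq by (rule square_integrable_add)

lemma L2_inner_commute: "L2_inner M X Y = L2_inner M Y X"
  by (simp add: L2_inner_def inner_commute)

lemma L2_inner_add_right:
  assumes "X \<in> L2_rv M" "Y \<in> L2_rv M" "Z \<in> L2_rv M"
  shows "L2_inner M X (\<lambda>\<omega>. Y \<omega> + Z \<omega>) = L2_inner M X Y + L2_inner M X Z"
  using assms by (simp add: L2_inner_def L2_rv_eq inner_add_right integrable_inner)

lemma L2_inner_diff_right:
  assumes "X \<in> L2_rv M" "Y \<in> L2_rv M" "Z \<in> L2_rv M"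
  shows "L2_inner M X (Y - Z) = L2_inner M X Y - L2_inner M X Z"
  using assms by (simp add: L2_inner_def L2_rv_eq inner_diff_right integrable_inner)

lemma L2_inner_cong_AE:
  assumes "AE \<omega> in M. Y \<omega> = Y' \<omega>" "X \<in> L2_rv M" "Y \<in> L2_rv M" "Y' \<in> L2_rv M"
  shows "L2_inner M X Y = L2_inner M X Y'"
proof -
  have [measurable]: "X \<in> borel_measurable M" "Y \<in> borel_measurable M" "Y' \<in> borel_measurable M"
    using assms by (auto simp: L2_rv_def)
  have "AE \<omega> in M. X \<omega> \<bullet> Y \<omega> = X \<omega> \<bullet> Y' \<omega>" using assms(1) by eventually_elim simp
  then show ?thesis unfolding L2_inner_def by (intro integral_cong_AE) auto
qed

lemma L2_Cauchy_Schwarz: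
  assumes "X \<in> L2_rv M" "Y \<in> L2_rv M"
  shows "\<bar>L2_inner M X Y\<bar> \<le> L2_norm M X * L2_norm M Y"
proof -
  have "(L2_inner M X Y)\<^sup>2 \<le> (L2_norm M X * L2_norm M Y)\<^sup>2"
    using Cauchy_Schwarz_integral[of M X Y] assms
    by (simp add: L2_rv_eq power_mult_distrib L2_norm_sq_integral) (simp add: L2_inner_def)
  then show ?thesis by (simp add: abs_le_square_iff [symmetric])
qed

section \<open>Laws of square integrable variables\<close>

lemma law_in_P2:
  assumes "prob_space M" "X \<in> L2_rv M"
  shows "law M X \<in> P2"
proof -
  interpret prob_space M by fact
  have [measurable]: "X \<in> borel_measurable M" using assms(2) by (simp add: L2_rv_def)
  show ?thesis using assms(2) prob_space_distr[of X borel]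
    by (simp add: P2_def L2_rv_def integrable_distr_eq)
qed

lemma E2_law:
  assumes "X \<in> L2_rv M"
  shows "E2 (law M X) = (L2_norm M X)\<^sup>2"
  using assms by (simp add: E2_def L2_norm_sq_integral integral_distr L2_rv_def)

text \<open>
  The joint law of \<open>(X, Y)\<close> is one of the couplings over which the infimum is taken.
\<close>

lemma W2_le_coupling:
  assumes "prob_space M" and [measurable]: "X \<in> borel_measurable M" "Y \<in> borel_measurable M"
    and "integrable M (\<lambda>\<omega>. (dist (X \<omega>) (Y \<omega>))\<^sup>2)"
  shows "W2 (law M X) (law M Y) \<le> sqrt (\<integral>\<omega>. (dist (X \<omega>) (Y \<omega>))\<^sup>2 \<partial>M)"
proof -
  interpret prob_space M by fact
  let ?c = "distr M (borel \<Otimes>\<^sub>M borel) (\<lambda>\<omega>. (X \<omega>, Y \<omega>))"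
  have c: "?c \<in> couplings (law M X) (law M Y)"
    unfolding couplings_def mem_Collect_eq
    using prob_space_distr[of "\<lambda>\<omega>. (X \<omega>, Y \<omega>)" "borel \<Otimes>\<^sub>M borel"]
    by (simp add: distr_distr o_def)
  have "(\<integral>\<^sup>+ (x, y). ennreal ((dist x y)\<^sup>2) \<partial>?c) = (\<integral>\<^sup>+ \<omega>. ennreal ((dist (X \<omega>) (Y \<omega>))\<^sup>2) \<partial>M)"
    unfolding split_beta' by (subst nn_integral_distr) auto
  also have "\<dots> = ennreal (\<integral>\<omega>. (dist (X \<omega>) (Y \<omega>))\<^sup>2 \<partial>M)"
    using assms(4) by (intro nn_integral_eq_integral) auto
  finally have "(INF \<pi> \<in> couplings (law M X) (law M Y). \<integral>\<^sup>+ (x, y). ennreal ((dist x y)\<^sup>2) \<partial>\<pi>)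
      \<le> ennreal (\<integral>\<omega>. (dist (X \<omega>) (Y \<omega>))\<^sup>2 \<partial>M)"
    using INF_lower[OF c, of "\<lambda>\<pi>. \<integral>\<^sup>+ (x, y). ennreal ((dist x y)\<^sup>2) \<partial>\<pi>"] by simp
  then have "enn2real (INF \<pi> \<in> couplings (law M X) (law M Y). \<integral>\<^sup>+ (x, y). ennreal ((dist x y)\<^sup>2) \<partial>\<pi>)
      \<le> (\<integral>\<omega>. (dist (X \<omega>) (Y \<omega>))\<^sup>2 \<partial>M)"
    by (intro enn2real_leI) auto
  then show ?thesis unfolding W2_def by simp
qed

lemma W2_law_le:
  assumes "prob_space M" "X \<in> L2_rv M" "Y \<in> L2_rv M"
  shows "W2 (law M X) (law M Y) \<le> L2_norm M (X - Y)"
proof -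
  have "(\<lambda>\<omega>. (norm (X \<omega> - Y \<omega>))\<^sup>2) = (\<lambda>\<omega>. (dist (X \<omega>) (Y \<omega>))\<^sup>2)" by (simp add: dist_norm)
  moreover have "L2_norm M (X - Y) = sqrt (\<integral>\<omega>. (norm (X \<omega> - Y \<omega>))\<^sup>2 \<partial>M)"
    using real_sqrt_unique[OF L2_norm_sq_integral[of M "X - Y"]] by simp
  ultimately show ?thesis
    using W2_le_coupling[OF assms(1), of X Y] L2_rv_diff[OF assms(2,3)] assms(2,3)
    by (simp add: L2_rv_def)
qed

lemma W2_self:
  assumes "\<mu> \<in> P2" shows "W2 \<mu> \<mu> = 0"
proof -
  have \<mu>: "prob_space \<mu>" "sets \<mu> = sets borel" using assms by (auto simp: P2_def)
  then have "law \<mu> (\<lambda>x. x) = \<mu>" by (intro distr_id2) simp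
  moreover have "W2 (law \<mu> (\<lambda>x. x)) (law \<mu> (\<lambda>x. x)) \<le> sqrt (\<integral>x. (dist x x)\<^sup>2 \<partial>\<mu>)"
    using \<mu> measurable_ident_sets[OF \<mu>(2)] by (intro W2_le_coupling) auto
  ultimately have "W2 \<mu> \<mu> \<le> 0" by simp
  moreover have "0 \<le> W2 \<mu> \<mu>" by (simp add: W2_def)
  ultimately show ?thesis by simp
qed

text \<open>
  Joint continuity restricts to a slice because \<open>W2 \<mu> \<mu> = 0\<close>. This gives the measurability of the
  coefficients at a fixed time.
\<close>

lemma continuous_P2_fixed_law:
  assumes "continuous_P2 f" "\<mu> \<in> P2"
  shows "continuous_on UNIV (\<lambda>x. f x \<mu>)"
  unfolding continuous_on_iff
proof (intro ballI allI impI)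
  fix x and e :: real assume "0 < e"
  have "\<exists>d>0. \<forall>x'. \<forall>\<mu>'\<in>P2. dist x' x < d \<and> W2 \<mu>' \<mu> < d \<longrightarrow> dist (f x' \<mu>') (f x \<mu>) < e"
    using assms(1)[unfolded continuous_P2_def, THEN spec, THEN bspec, OF assms(2)] \<open>0 < e\<close> by simp
  then obtain d where "d > 0"
    "\<forall>x'. \<forall>\<mu>'\<in>P2. dist x' x < d \<and> W2 \<mu>' \<mu> < d \<longrightarrow> dist (f x' \<mu>') (f x \<mu>) < e"
    by (elim exE conjE)
  then show "\<exists>d>0. \<forall>x'\<in>UNIV. dist x' x < d \<longrightarrow> dist (f x' \<mu>) (f x \<mu>) < e"
    using W2_self[OF assms(2)] assms(2) by (intro exI[of _ d]) simp
qed

section \<open>Square integrable processes\<close>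

text \<open>
  Time is the interval \<open>[0,T]\<close> with its own finite Lebesgue measure \<open>\<L>\<close>, so that \<open>\<L> \<Otimes> M\<close> is a finite
  product measure on which square integrable functions are integrable.
\<close>

locale time_horizon = prob_space M for M :: "'a measure" +
  fixes T :: real
  assumes T_pos: "0 < T"
begin

abbreviation \<L> :: "real measure" where "\<L> \<equiv> restrict_space lborel {0..T}"

text \<open>
  Square integrability on the product only controls almost every time; the energy estimates are evaluated
  at fixed times, which is why each \<open>V t\<close> is required to be square integrable as well.
\<close>

definition process :: "(real \<Rightarrow> 'a \<Rightarrow> real^'d) \<Rightarrow> bool" where
  "process V \<longleftrightarrow> square_integrable (\<L> \<Otimes>\<^sub>M M) (\<lambda>(t, \<omega>). V t \<omega>) \<and> (\<forall>t\<in>{0..T}. V t \<in> L2_rv M)"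

lemma finite_measure_time: "finite_measure \<L>"
  by (rule finite_measureI) (use T_pos in \<open>simp add: space_restrict_space emeasure_restrict_space\<close>)

end

sublocale time_horizon \<subseteq> time: finite_measure \<L>
  by (rule finite_measure_time)

sublocale time_horizon \<subseteq> time_space: pair_sigma_finite \<L> M ..

sublocale time_horizon \<subseteq> time_time: pair_sigma_finite \<L> \<L> ..

context time_horizon
begin

lemma space_time [simp]: "space \<L> = {0..T}"
  by (simp add: space_restrict_space)

lemma Icc_sets_time: "0 \<le> a \<Longrightarrow> b \<le> T \<Longrightarrow> {a..b} \<in> sets \<L>"
  by (auto simp: sets_restrict_space intro!: image_eqI[of _ _ "{a..b}"])

lemma measure_time_Icc: "0 \<le> a \<Longrightarrow> a \<le> b \<Longrightarrow> b \<le> T \<Longrightarrow> measure \<L> {a..b} = b - a"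
  by (subst measure_restrict_space) auto

lemma set_integral_time:
  fixes f :: "real \<Rightarrow> 'e::euclidean_space"
  assumes "0 \<le> a" "b \<le> T"
  shows "(LINT s:{a..b}|lborel. f s) = (LINT s:{a..b}|\<L>. f s)"
    and "set_integrable lborel {a..b} f \<longleftrightarrow> set_integrable \<L> {a..b} f"
proof -
  have *: "(indicator {0..T} s * indicator {a..b} s) *\<^sub>R f s = indicator {a..b} s *\<^sub>R f s" for s
    using assms by (auto simp: indicator_def)
  show "(LINT s:{a..b}|lborel. f s) = (LINT s:{a..b}|\<L>. f s)"
    unfolding set_lebesgue_integral_def by (subst integral_restrict_space) (simp_all add: *)
  show "set_integrable lborel {a..b} f \<longleftrightarrow> set_integrable \<L> {a..b} f"
    unfolding set_integrable_def by (subst integrable_restrict_space) (simp_all add: *)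
qed

lemma set_integrable_time:
  fixes f :: "real \<Rightarrow> 'e::euclidean_space"
  assumes "integrable \<L> f" "0 \<le> a" "b \<le> T"
  shows "set_integrable \<L> {a..b} f"
  unfolding set_integrable_def
  by (rule integrable_mult_indicator) (use assms Icc_sets_time in auto)

lemma set_integral_time_full:
  fixes f :: "real \<Rightarrow> 'e::euclidean_space"
  shows "(LINT s:{0..T}|\<L>. f s) = (\<integral>s. f s \<partial>\<L>)"
  unfolding set_lebesgue_integral_def
  by (intro Bochner_Integration.integral_cong) auto

lemma set_integral_time_split:
  fixes f :: "real \<Rightarrow> 'e::euclidean_space"
  assumes f: "set_integrable \<L> {a..b} f" and "0 \<le> a" "a \<le> s" "s \<le> b" "b \<le> T"
  shows "(LINT r:{a..b}|\<L>. f r) = (LINT r:{a..s}|\<L>. f r) + (LINT r:{s..b}|\<L>. f r)"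
proof -
  have "{a..s} \<union> {s..b} = {a..b}" using assms by auto
  moreover have "(LINT r:{a..s} \<union> {s..b}|\<L>. f r) = (LINT r:{a..s}|\<L>. f r) + (LINT r:{s..b}|\<L>. f r)"
  proof (rule set_integral_Un_AE)
    have "AE x in \<L>. x \<noteq> s"
      by (subst AE_restrict_space_iff) (use AE_lborel_singleton[of s] in \<open>auto elim: eventually_mono\<close>)
    then show "AE x in \<L>. \<not> (x \<in> {a..s} \<and> x \<in> {s..b})" by eventually_elim auto
    show "set_integrable \<L> {a..s} f" "set_integrable \<L> {s..b} f"
      by (rule set_integrable_subset[OF f]; use assms in \<open>auto intro!: Icc_sets_time\<close>)+
  qed (use assms in \<open>auto intro!: Icc_sets_time\<close>)
  ultimately show ?thesis by simp
qed

lemma processD: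
  assumes "process V"
  shows "square_integrable (\<L> \<Otimes>\<^sub>M M) (\<lambda>(t, \<omega>). V t \<omega>)" "t \<in> {0..T} \<Longrightarrow> V t \<in> L2_rv M"
  using assms by (auto simp: process_def)

lemma process_measurable:
  assumes "process V"
  shows "(\<lambda>(t, \<omega>). V t \<omega>) \<in> borel_measurable (\<L> \<Otimes>\<^sub>M M)"
  using assms by (auto simp: process_def square_integrable_def)

lemma process_diff:
  assumes "process V" "process V'"
  shows "process (\<lambda>t. V t - V' t)"
  using square_integrable_diff[OF processD(1)[OF assms(1)] processD(1)[OF assms(2)]]
    processD(2)[OF assms(1)] processD(2)[OF assms(2)] 
  unfolding process_def by (auto simp: split_beta' intro: L2_rv_diff)

lemma integrable_time_space_fst:
  fixes \<phi> :: "real \<Rightarrow> real"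
  assumes "integrable \<L> \<phi>"
  shows "integrable (\<L> \<Otimes>\<^sub>M M) (\<lambda>(t, \<omega>). \<phi> t)"
proof -
  have [measurable]: "\<phi> \<in> borel_measurable \<L>" using assms by simp
  show ?thesis by (rule time_space.Fubini_integrable) (use assms in \<open>auto simp: prob_space\<close>)
qed

lemma process_const:
  assumes "\<xi> \<in> L2_rv M"
  shows "process (\<lambda>_. \<xi>)"
proof -
  have [measurable]: "\<xi> \<in> borel_measurable M" and i: "integrable M (\<lambda>\<omega>. (norm (\<xi> \<omega>))\<^sup>2)"
    using assms by (auto simp: L2_rv_def)
  have "integrable (\<L> \<Otimes>\<^sub>M M) (\<lambda>(t, \<omega>). (norm (\<xi> \<omega>))\<^sup>2)"
    by (rule time_space.Fubini_integrable) (use i in auto)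
  then show ?thesis using assms
    by (simp add: process_def square_integrable_def split_beta')
qed

lemma process_inner_integrable:
  assumes "process V" "process V'"
  shows "integrable \<L> (\<lambda>s. L2_inner M (V s) (V' s))"
  using time_space.integrable_fst'[OF integrable_inner[OF processD(1)[OF assms(1)] processD(1)[OF assms(2)]]]
  by (simp add: L2_inner_def)

lemma process_path_square_integrable:
  fixes V :: "real \<Rightarrow> 'a \<Rightarrow> 'e::euclidean_space"
  assumes "square_integrable (\<L> \<Otimes>\<^sub>M M) (\<lambda>(t, \<omega>). V t \<omega>)"
  shows "AE \<omega> in M. square_integrable \<L> (\<lambda>t. V t \<omega>)"
proof -
  note [measurable] = square_integrableD(1)[OF assms]
  have "integrable (\<L> \<Otimes>\<^sub>M M) (\<lambda>(t, \<omega>). (norm (V t \<omega>))\<^sup>2)"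
    using square_integrableD(2)[OF assms] by (simp add: split_beta')
  from time_space.AE_integrable_snd[OF this] AE_space
  show ?thesis
  proof eventually_elim
    case (elim \<omega>)
    have "(\<lambda>t. V t \<omega>) \<in> borel_measurable \<L>" 
      using measurable_compose[OF measurable_Pair2'[OF elim(2)] square_integrableD(1)[OF assms]]
      by simp
    with elim show ?case by (simp add: square_integrable_def)
  qed
qed

lemma time_integral_L2:
  assumes V: "process V" and A: "A \<in> sets \<L>"
  shows "(\<lambda>\<omega>. LINT s:A|\<L>. V s \<omega>) \<in> L2_rv M"
proof -
  note [measurable] = process_measurable[OF V] A
  have m: "(\<lambda>\<omega>. LINT s:A|\<L>. V s \<omega>) \<in> borel_measurable M"
    unfolding set_lebesgue_integral_def by measurable
  have "integrable (\<L> \<Otimes>\<^sub>M M) (\<lambda>(t, \<omega>). (norm (V t \<omega>))\<^sup>2)"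
    using square_integrableD(2)[OF processD(1)[OF V]] by (simp add: split_beta')
  from time_space.integrable_snd[OF this]
  have i: "integrable M (\<lambda>\<omega>. measure \<L> A * (\<integral>s. (norm (V s \<omega>))\<^sup>2 \<partial>\<L>))" by simp
  have "integrable M (\<lambda>\<omega>. (norm (LINT s:A|\<L>. V s \<omega>))\<^sup>2)"
  proof (rule Bochner_Integration.integrable_bound[OF i])
    show "(\<lambda>\<omega>. (norm (LINT s:A|\<L>. V s \<omega>))\<^sup>2) \<in> borel_measurable M" using m by simp
    from process_path_square_integrable[OF processD(1)[OF V]]
    show "AE \<omega> in M. norm ((norm (LINT s:A|\<L>. V s \<omega>))\<^sup>2)
        \<le> norm (measure \<L> A * (\<integral>s. (norm (V s \<omega>))\<^sup>2 \<partial>\<L>))"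
    proof eventually_elim
      case (elim \<omega>)
      have "emeasure \<L> A < \<infinity>" by (simp add: time.emeasure_eq_measure)
      from norm_set_integral_sq_le[OF elim A this] show ?case by simp
    qed
  qed
  with m show ?thesis by (simp add: L2_rv_def)
qed

text \<open>
  Fubini for one process. It reduces every pairing with a time integral to a scalar integral of inner
  products; after this point paths no longer occur in the energy computations.
\<close>

lemma inner_time_integral:
  assumes V: "process V" and \<xi>: "\<xi> \<in> L2_rv M" and A: "A \<in> sets \<L>"
  shows "L2_inner M \<xi> (\<lambda>\<omega>. LINT s:A|\<L>. V s \<omega>) = (LINT s:A|\<L>. L2_inner M \<xi> (V s))"
proof -
  note [measurable] = process_measurable[OF V] A
  have [measurable]: "\<xi> \<in> borel_measurable M" using \<xi> by (simp add: L2_rv_def)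
  have i: "integrable (\<L> \<Otimes>\<^sub>M M) (\<lambda>(s, \<omega>). \<xi> \<omega> \<bullet> V s \<omega>)"
    using integrable_inner[OF processD(1)[OF process_const[OF \<xi>]] processD(1)[OF V]]
    by (simp add: split_beta')
  have iA: "integrable (\<L> \<Otimes>\<^sub>M M) (\<lambda>(s, \<omega>). indicator A s * (\<xi> \<omega> \<bullet> V s \<omega>))"
  proof (rule Bochner_Integration.integrable_bound[OF i])
    show "(\<lambda>(s, \<omega>). indicator A s * (\<xi> \<omega> \<bullet> V s \<omega>)) \<in> borel_measurable (\<L> \<Otimes>\<^sub>M M)" by measurable
  qed (auto simp: indicator_def)
  have "L2_inner M \<xi> (\<lambda>\<omega>. LINT s:A|\<L>. V s \<omega>)
      = (\<integral>\<omega>. (\<integral>s. indicator A s * (\<xi> \<omega> \<bullet> V s \<omega>) \<partial>\<L>) \<partial>M)"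
    unfolding L2_inner_def
  proof (rule integral_cong_AE)
    have "(\<lambda>\<omega>. LINT s:A|\<L>. V s \<omega>) \<in> borel_measurable M"
      using time_integral_L2[OF V A] by (simp add: L2_rv_def)
    then show "(\<lambda>\<omega>. \<xi> \<omega> \<bullet> (LINT s:A|\<L>. V s \<omega>)) \<in> borel_measurable M" by measurable
    show "(\<lambda>\<omega>. \<integral>s. indicator A s * (\<xi> \<omega> \<bullet> V s \<omega>) \<partial>\<L>) \<in> borel_measurable M" by measurable
    from process_path_square_integrable[OF processD(1)[OF V]]
    show "AE \<omega> in M. \<xi> \<omega> \<bullet> (LINT s:A|\<L>. V s \<omega>) = (\<integral>s. indicator A s * (\<xi> \<omega> \<bullet> V s \<omega>) \<partial>\<L>)"
    proof eventually_elim
      case (elim \<omega>)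
      have "integrable \<L> (\<lambda>s. V s \<omega>)" by (rule time.integrable_square_integrable[OF elim])
      then have "integrable \<L> (\<lambda>s. indicator A s *\<^sub>R V s \<omega>)"
        by (rule integrable_mult_indicator[OF A])
      then show ?case unfolding set_lebesgue_integral_def
        by (subst integral_inner_right[symmetric]) simp_all
    qed
  qed
  also have "\<dots> = (\<integral>s. (\<integral>\<omega>. indicator A s * (\<xi> \<omega> \<bullet> V s \<omega>) \<partial>M) \<partial>\<L>)"
    by (rule time_space.Fubini_integral[OF iA])
  also have "\<dots> = (LINT s:A|\<L>. L2_inner M \<xi> (V s))"
    by (simp add: set_lebesgue_integral_def L2_inner_def)
  finally show ?thesis .
qed

section \<open>Fubini on the triangle\<close>

lemma process_kernel_integrable:
  assumes V: "process V" and V': "process V'"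
  shows "integrable (\<L> \<Otimes>\<^sub>M \<L>) (\<lambda>(r, s). L2_inner M (V r) (V' s))"
proof -
  note [measurable] = process_measurable[OF V] process_measurable[OF V']
  have m[measurable]: "(\<lambda>(r, s). L2_inner M (V r) (V' s)) \<in> borel_measurable (\<L> \<Otimes>\<^sub>M \<L>)"
  proof -
    have [measurable]: "(\<lambda>z. V (fst (fst z)) (snd z)) \<in> borel_measurable ((\<L> \<Otimes>\<^sub>M \<L>) \<Otimes>\<^sub>M M)"
      using measurable_compose[OF _ process_measurable[OF V], of "\<lambda>z. (fst (fst z), snd z)"] by simp
    have [measurable]: "(\<lambda>z. V' (snd (fst z)) (snd z)) \<in> borel_measurable ((\<L> \<Otimes>\<^sub>M \<L>) \<Otimes>\<^sub>M M)"
      using measurable_compose[OF _ process_measurable[OF V'], of "\<lambda>z. (snd (fst z), snd z)"] by simp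
    show ?thesis unfolding L2_inner_def split_beta' 
      by (rule borel_measurable_lebesgue_integral) (simp add: split_beta')
  qed
  have p: "integrable (\<L> \<Otimes>\<^sub>M \<L>) (\<lambda>(r, s). (L2_norm M (V r))\<^sup>2)"
    "integrable (\<L> \<Otimes>\<^sub>M \<L>) (\<lambda>(r, s). (L2_norm M (V' s))\<^sup>2)"
  proof -
    have *: "integrable \<L> (\<lambda>r. (L2_norm M (V r))\<^sup>2)" "integrable \<L> (\<lambda>r. (L2_norm M (V' r))\<^sup>2)"
      unfolding L2_norm_sq using process_inner_integrable V V' by auto
    then have [measurable]: "(\<lambda>r. (L2_norm M (V r))\<^sup>2) \<in> borel_measurable \<L>"
      "(\<lambda>r. (L2_norm M (V' r))\<^sup>2) \<in> borel_measurable \<L>" by auto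
    show "integrable (\<L> \<Otimes>\<^sub>M \<L>) (\<lambda>(r, s). (L2_norm M (V r))\<^sup>2)"
      by (rule time_time.Fubini_integrable) (use * in auto)
    show "integrable (\<L> \<Otimes>\<^sub>M \<L>) (\<lambda>(r, s). (L2_norm M (V' s))\<^sup>2)"
      by (rule time_time.Fubini_integrable) (use * in auto)
  qed
  show ?thesis
  proof (rule Bochner_Integration.integrable_bound[OF Bochner_Integration.integrable_add[OF p] m])
    have "\<bar>L2_inner M (V r) (V' s)\<bar> \<le> (L2_norm M (V r))\<^sup>2 + (L2_norm M (V' s))\<^sup>2"
      if "r \<in> {0..T}" "s \<in> {0..T}" for r s
    proof -
      have "0 \<le> L2_norm M (V r) * L2_norm M (V' s)" by simp
      then show ?thesis
        using L2_Cauchy_Schwarz[OF processD(2)[OF V that(1)] processD(2)[OF V' that(2)]]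
          sum_squares_bound[of "L2_norm M (V r)" "L2_norm M (V' s)"] by linarith
    qed
    then show "AE z in \<L> \<Otimes>\<^sub>M \<L>. norm (case z of (r, s) \<Rightarrow> L2_inner M (V r) (V' s))
      \<le> norm ((case z of (r, s) \<Rightarrow> (L2_norm M (V r))\<^sup>2) + (case z of (r, s) \<Rightarrow> (L2_norm M (V' s))\<^sup>2))"
      by (intro AE_I2) (auto simp: space_pair_measure)
  qed
qed

text \<open>
  Both sides integrate \<open>K\<close> over the triangle \<open>a \<le> r \<le> s \<le> b\<close>.
\<close>

lemma triangle_Fubini:
  fixes K :: "real \<Rightarrow> real \<Rightarrow> real"
  assumes K: "integrable (\<L> \<Otimes>\<^sub>M \<L>) (\<lambda>(r, s). K r s)" and ab: "0 \<le> a" "b \<le> T"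
  shows "(LINT s:{a..b}|\<L>. LINT r:{a..s}|\<L>. K r s) = (LINT r:{a..b}|\<L>. LINT s:{r..b}|\<L>. K r s)"
    and "set_integrable \<L> {a..b} (\<lambda>s. LINT r:{a..s}|\<L>. K r s)"
    and "set_integrable \<L> {a..b} (\<lambda>r. LINT s:{r..b}|\<L>. K r s)"
proof -
  define Kd where "Kd r s = of_bool (a \<le> r \<and> r \<le> s \<and> s \<le> b) * K r s" for r s
  note [measurable] = borel_measurable_integrable[OF K]
  have id[measurable]: "(\<lambda>x. x) \<in> borel_measurable \<L>" by (simp add: measurable_restrict_space1)
  have iKd: "integrable (\<L> \<Otimes>\<^sub>M \<L>) (\<lambda>(r, s). Kd r s)"
  proof (rule Bochner_Integration.integrable_bound[OF K])
    have [measurable]: "fst \<in> borel_measurable (\<L> \<Otimes>\<^sub>M \<L>)" "snd \<in> borel_measurable (\<L> \<Otimes>\<^sub>M \<L>)"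
      using measurable_compose[OF measurable_fst id] measurable_compose[OF measurable_snd id] by auto
    show "(\<lambda>(r, s). Kd r s) \<in> borel_measurable (\<L> \<Otimes>\<^sub>M \<L>)"
      unfolding Kd_def split_beta' by measurable
  qed (auto simp: Kd_def)
  have 1: "indicator {a..b} s *\<^sub>R (LINT r:{a..s}|\<L>. K r s) = (\<integral>r. Kd r s \<partial>\<L>)" for s
    unfolding set_lebesgue_integral_def integral_scaleR_right[symmetric]
    by (intro Bochner_Integration.integral_cong) (auto simp: indicator_def Kd_def)
  have 2: "indicator {a..b} r *\<^sub>R (LINT s:{r..b}|\<L>. K r s) = (\<integral>s. Kd r s \<partial>\<L>)" for r
    unfolding set_lebesgue_integral_def integral_scaleR_right[symmetric]
    by (intro Bochner_Integration.integral_cong) (auto simp: indicator_def Kd_def)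
  show "(LINT s:{a..b}|\<L>. LINT r:{a..s}|\<L>. K r s) = (LINT r:{a..b}|\<L>. LINT s:{r..b}|\<L>. K r s)"
    unfolding set_lebesgue_integral_def[of _ "{a..b}"] 1 2 by (rule time_time.Fubini_integral[OF iKd])
  show "set_integrable \<L> {a..b} (\<lambda>s. LINT r:{a..s}|\<L>. K r s)"
    unfolding set_integrable_def 1 by (rule time_time.integrable_snd[OF iKd])
  show "set_integrable \<L> {a..b} (\<lambda>r. LINT s:{r..b}|\<L>. K r s)"
    unfolding set_integrable_def 2 by (rule time_time.integrable_fst[OF iKd])
qed

text \<open>
  The kernel is symmetric, so the two triangles that make up the square contribute equally. This is the
  integrated form of \<open>d (P\<^sup>2) = 2 P dP\<close> for \<open>P\<close> a time integral.
\<close>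

lemma square_Fubini_symmetric:
  assumes V: "process V" and ab: "0 \<le> a" "b \<le> T"
  defines "K \<equiv> \<lambda>r s. L2_inner M (V r) (V s)"
  shows "(LINT s:{a..b}|\<L>. LINT r:{a..b}|\<L>. K r s) = 2 * (LINT s:{a..b}|\<L>. LINT r:{a..s}|\<L>. K r s)"
    and "(LINT s:{a..b}|\<L>. LINT r:{a..b}|\<L>. K r s) = 2 * (LINT s:{a..b}|\<L>. LINT r:{s..b}|\<L>. K r s)"
proof -
  have K: "integrable (\<L> \<Otimes>\<^sub>M \<L>) (\<lambda>(r, s). K r s)"
    unfolding K_def by (rule process_kernel_integrable[OF V V])
  have sym: "K r s = K s r" for r s by (simp add: K_def L2_inner_commute)
  note F = triangle_Fubini[OF K ab]
  have i: "integrable \<L> (\<lambda>r. K r s)" if "s \<in> {a..b}" for s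
    unfolding K_def by (intro process_inner_integrable V process_const processD) (use that ab in auto)
  have "(LINT s:{a..b}|\<L>. LINT r:{a..b}|\<L>. K r s)
      = (LINT s:{a..b}|\<L>. (LINT r:{a..s}|\<L>. K r s) + (LINT r:{s..b}|\<L>. K r s))"
    using Icc_sets_time[OF ab]
    by (intro set_lebesgue_integral_cong) (use ab i in \<open>auto intro!: set_integral_time_split set_integrable_time\<close>)
  also have "\<dots> = (LINT s:{a..b}|\<L>. LINT r:{a..s}|\<L>. K r s) + (LINT s:{a..b}|\<L>. LINT r:{s..b}|\<L>. K r s)"
    using F(2,3) by (intro set_integral_add) (simp_all add: sym[of _ "_ :: real"])
  finally have *: "(LINT s:{a..b}|\<L>. LINT r:{a..b}|\<L>. K r s) = \<dots>" .
  have "(LINT s:{a..b}|\<L>. LINT r:{s..b}|\<L>. K r s) = (LINT s:{a..b}|\<L>. LINT r:{s..b}|\<L>. K s r)"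
    by (subst sym) (rule refl)
  also have "\<dots> = (LINT s:{a..b}|\<L>. LINT r:{a..s}|\<L>. K r s)" using F(1) by simp
  finally show "(LINT s:{a..b}|\<L>. LINT r:{a..b}|\<L>. K r s) = 2 * (LINT s:{a..b}|\<L>. LINT r:{a..s}|\<L>. K r s)"
    "(LINT s:{a..b}|\<L>. LINT r:{a..b}|\<L>. K r s) = 2 * (LINT s:{a..b}|\<L>. LINT r:{s..b}|\<L>. K r s)"
    using * by simp_all
qed

end

section \<open>Real inequalities\<close>

lemma powr_le_one_plus:
  fixes y g :: real
  assumes "0 \<le> y" "0 < g" "g \<le> 1"
  shows "y powr g \<le> 1 + y"
proof (cases "y \<le> 1")
  case True
  then have "y powr g \<le> 1" using assms by (intro powr_le1) auto
  then show ?thesis using assms by simp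
next
  case False
  then have "y powr g \<le> y powr 1" using assms by (intro powr_mono) auto
  then show ?thesis using False by simp
qed

lemma max_powr_sq_le:
  fixes p g :: real
  assumes "0 \<le> p"
  shows "(max p (p powr g))\<^sup>2 \<le> p\<^sup>2 + (p\<^sup>2) powr g"
proof -
  have "(p\<^sup>2) powr g = (p powr g)\<^sup>2"
    using assms by (simp add: power2_eq_square powr_mult)
  then show ?thesis by (auto simp: max_def)
qed

text \<open>
  The left side weights \<open>N\<close> and \<open>q\<close> with exponents that add up to \<open>2\<close>, and moving weight from the
  smaller number \<open>N\<close> to the larger number \<open>q\<close> increases the product.
\<close>

lemma powr_interpolation:
  fixes N q g :: real
  assumes "0 \<le> N" "N \<le> q" "0 < g" "g \<le> 1"
  shows "N powr (2 - g) * q powr g \<le> N * q"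
proof (cases "N = 0")
  case False
  then have N: "0 < N" "0 < q" using assms by auto
  have "N powr (2 - g) * q powr g = N * (N powr (1 - g) * q powr g)"
    using N powr_add[of N 1 "1 - g"] by simp
  also have "\<dots> \<le> N * (q powr (1 - g) * q powr g)"
    using assms N by (intro mult_left_mono mult_right_mono powr_mono2) auto
  also have "q powr (1 - g) * q powr g = q" using N by (simp flip: powr_add)
  finally show ?thesis .
qed simp

text \<open>
  For \<open>p0 \<le> 1\<close> the maxima are the powers, and \<open>p0\<^sup>g = N\<^sup>2\<^sup>-\<^sup>g\<close> and \<open>N\<^sup>g = N'\<close> hold with equality: this is
  what fixes the exponents \<open>g / (2 - g)\<close> and \<open>g\<^sup>2 / (2 - g)\<close>. For \<open>p0 \<ge> 1\<close> both maxima are \<open>p0\<close>.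
\<close>

lemma two_scale_norm:
  fixes p0 g :: real
  assumes "0 \<le> p0" "0 < g" "g \<le> 1"
  defines "N \<equiv> max p0 (p0 powr (g / (2 - g)))" and "N' \<equiv> max p0 (p0 powr (g\<^sup>2 / (2 - g)))"
  shows "p0 \<le> N" "p0 powr g \<le> N powr (2 - g)" "N \<le> N'" "N powr g \<le> N'"
proof -
  show "p0 \<le> N" by (simp add: N_def)
  have b: "0 \<le> g / (2 - g)" "g / (2 - g) \<le> 1" using assms by auto
  have gg: "g * g \<le> g" using assms mult_left_mono[of g 1 g] by simp
  consider "p0 = 0" | "0 < p0" "p0 \<le> 1" | "1 < p0" using assms(1) by linarith
  then have "p0 powr g \<le> N powr (2 - g) \<and> N \<le> N' \<and> N powr g \<le> N'"
  proof cases
    case 1 then show ?thesis by (simp add: N_def N'_def)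
  next
    case 2
    then have "p0 powr 1 \<le> p0 powr (g / (2 - g))" using b by (intro powr_mono') auto
    then have N: "N = p0 powr (g / (2 - g))" using 2 by (simp add: N_def)
    have "p0 powr g = N powr (2 - g)" using 2 assms by (simp add: N powr_powr)
    moreover have "N powr g = p0 powr (g\<^sup>2 / (2 - g))"
      using 2 by (simp add: N powr_powr power2_eq_square)
    moreover have "N \<le> p0 powr (g\<^sup>2 / (2 - g))"
      unfolding N using 2 assms gg by (intro powr_mono') (auto simp: power2_eq_square divide_right_mono)
    ultimately show ?thesis by (simp add: N'_def)
  next
    case 3
    then have "p0 powr (g / (2 - g)) \<le> p0 powr 1" using b by (intro powr_mono) auto
    then have N: "N = p0" using 3 by (simp add: N_def)
    have "p0 powr g \<le> p0 powr (2 - g)" "p0 powr g \<le> p0 powr 1" using 3 assms by (intro powr_mono; simp)+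
    then show ?thesis using 3 by (simp add: N N'_def)
  qed
  then show "p0 powr g \<le> N powr (2 - g)" "N \<le> N'" "N powr g \<le> N'" by auto
qed

text \<open>
  The product \<open>p0 q0\<close> bounds \<open>q0\<^sup>2\<close>, so \<open>q0\<close> can be absorbed. If \<open>q0 > N\<close>, interpolation bounds
  \<open>(p0 q0)\<^sup>g\<close> by \<open>N\<^sup>2\<^sup>-\<^sup>g q0\<^sup>g \<le> N q0\<close>, and dividing \<open>q0\<^sup>2 \<le> 2 K N q0\<close> by \<open>q0\<close> shows that \<open>q0\<close> is at most a
  multiple of \<open>N\<close> in every case. The product is monotone in \<open>q0\<close>, and at this multiple it is of size \<open>N\<^sup>2\<close>.
\<close>

lemma absorb_product:
  fixes p0 q0 K g N :: real
  assumes "0 \<le> p0" "0 \<le> q0" "0 \<le> K" "0 < g" "g \<le> 1"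
    and N: "p0 \<le> N" "p0 powr g \<le> N powr (2 - g)"
    and q0: "q0\<^sup>2 \<le> K * (p0 * q0 + (p0 * q0) powr g)"
  shows "p0 * q0 + (p0 * q0) powr g \<le> 2 * (1 + 2 * K) * N\<^sup>2"
proof -
  have N0: "0 \<le> N" using assms by linarith
  have mix: "p0 * q + (p0 * q) powr g \<le> 2 * (N * q)" if "N \<le> q" for q
  proof -
    have q: "0 \<le> q" using N0 that by linarith
    have "(p0 * q) powr g = p0 powr g * q powr g" using assms q by (simp add: powr_mult)
    also have "\<dots> \<le> N powr (2 - g) * q powr g" using N by (intro mult_right_mono) auto
    also have "\<dots> \<le> N * q" by (rule powr_interpolation[OF N0 that assms(4,5)])
    finally show ?thesis using mult_right_mono[OF N(1) q] by linarith
  qed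
  have le: "q0 \<le> (1 + 2 * K) * N"
  proof (cases "N < q0")
    case True
    then have "q0\<^sup>2 \<le> K * (2 * (N * q0))"
      using q0 mult_left_mono[OF mix[of q0] assms(3)] by linarith
    then have "q0 * q0 \<le> (2 * K * N) * q0" by (simp add: power2_eq_square algebra_simps)
    then have "q0 \<le> 2 * K * N" using True N0 by (intro mult_right_le_imp_le[of q0 q0 "2 * K * N"]) auto
    then show ?thesis using N0 by (simp add: algebra_simps)
  next
    case False
    moreover have "0 \<le> 2 * K * N" using N0 assms(3) by simp
    ultimately show ?thesis by (simp add: distrib_right)
  qed
  have big: "N \<le> (1 + 2 * K) * N" using N0 assms(3) by (simp add: algebra_simps)
  have "p0 * q0 \<le> p0 * ((1 + 2 * K) * N)" using le assms(1) by (rule mult_left_mono)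
  moreover from this have "(p0 * q0) powr g \<le> (p0 * ((1 + 2 * K) * N)) powr g"
    using assms by (intro powr_mono2) auto
  ultimately have "p0 * q0 + (p0 * q0) powr g \<le> 2 * (N * ((1 + 2 * K) * N))"
    using mix[OF big] by linarith
  then show ?thesis by (simp add: power2_eq_square algebra_simps)
qed

text \<open>
  The numerical end of the argument. Here \<open>p0\<close> and \<open>q0\<close> are the norms at time \<open>0\<close> of the differences of
  the forward and the backward components, \<open>H\<close> is the squared norm of the difference of the terminal
  conditions, \<open>A\<close> the time integral of the squared norm of the forward difference, and \<open>Q\<close> the Gronwall
  bound for the squared backward difference. The constant is chosen before these quantities, hence it
  depends on the data only.
\<close>

lemma closing_estimate:
  fixes a0 \<alpha> c T E g :: real
  assumes "0 < a0" "0 < \<alpha>" "0 \<le> c" "0 < T" "0 \<le> E" and g: "0 < g" "g \<le> 1"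
  shows "\<exists>C\<ge>0. \<forall>p0 q0 A H Q. 0 \<le> p0 \<longrightarrow> 0 \<le> q0 \<longrightarrow> 0 \<le> A \<longrightarrow> 0 \<le> H \<longrightarrow>
    a0 * H + \<alpha> * A \<le> p0 * q0 \<longrightarrow> Q = E * (H + 2 * c * (A + (1 + T) * A powr g)) \<longrightarrow> q0\<^sup>2 \<le> Q \<longrightarrow>
    Q \<le> (C * max p0 (p0 powr (g / (2 - g))))\<^sup>2 \<and>
    p0\<^sup>2 + 2 * c * (A + (1 + T) * A powr g + T * (Q + Q powr g))
      \<le> (C * max p0 (p0 powr (g\<^sup>2 / (2 - g))))\<^sup>2"
proof -
  define L where "L = 1 / \<alpha> + (1 + T) * (1 / \<alpha>) powr g"
  define K where "K = E * (1 / a0 + 2 * c * L)"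
  define S where "S = 2 * (1 + 2 * K)"
  define R where "R = 1 + 2 * c * (L * S + T * (K * S + (K * S) powr g))"
  have L0: "0 \<le> L" using assms by (simp add: L_def)
  then have K0: "0 \<le> K" using assms by (simp add: K_def)
  then have S0: "0 \<le> S" by (simp add: S_def)
  have R0: "0 \<le> R" using assms L0 K0 S0 by (simp add: R_def)
  define C where "C = max (sqrt (K * S)) (sqrt R)"
  have C: "K * S \<le> C\<^sup>2" "R \<le> C\<^sup>2" "0 \<le> C"
  proof -
    show C0: "0 \<le> C" using R0 by (simp add: C_def le_max_iff_disj)
    have "(sqrt (K * S))\<^sup>2 \<le> C\<^sup>2" "(sqrt R)\<^sup>2 \<le> C\<^sup>2"
      using K0 S0 R0 by (intro power_mono; simp add: C_def)+
    then show "K * S \<le> C\<^sup>2" "R \<le> C\<^sup>2" using K0 S0 R0 by auto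
  qed
  have main: "Q \<le> (C * max p0 (p0 powr (g / (2 - g))))\<^sup>2 \<and>
    p0\<^sup>2 + 2 * c * (A + (1 + T) * A powr g + T * (Q + Q powr g))
      \<le> (C * max p0 (p0 powr (g\<^sup>2 / (2 - g))))\<^sup>2"
    if nn: "0 \<le> p0" "0 \<le> q0" "0 \<le> A" "0 \<le> H"
      and e: "a0 * H + \<alpha> * A \<le> p0 * q0" and Q: "Q = E * (H + 2 * c * (A + (1 + T) * A powr g))"
      and qQ: "q0\<^sup>2 \<le> Q" for p0 q0 A H Q
  proof -
    define N where "N = max p0 (p0 powr (g / (2 - g)))"
    define N' where "N' = max p0 (p0 powr (g\<^sup>2 / (2 - g)))"
    note NN = two_scale_norm[OF nn(1) g, folded N_def N'_def]
    have N0: "0 \<le> N" using NN nn by linarith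
    define D where "D = p0 * q0"
    have D0: "0 \<le> D" using nn by (simp add: D_def)
    have "0 \<le> a0 * H" "0 \<le> \<alpha> * A" using nn assms by simp_all
    then have "a0 * H \<le> D" "\<alpha> * A \<le> D" using e by (simp_all only: D_def)
    then have H: "H \<le> 1 / a0 * D" and A: "A \<le> 1 / \<alpha> * D" using assms by (simp_all add: field_simps)
    have "A powr g \<le> (1 / \<alpha> * D) powr g" using A nn g by (intro powr_mono2) auto
    also have "\<dots> = (1 / \<alpha>) powr g * D powr g" by (rule powr_mult)
    finally have "(1 + T) * A powr g \<le> (1 + T) * ((1 / \<alpha>) powr g * D powr g)"
      using assms by (intro mult_left_mono) auto
    moreover have "0 \<le> (1 + T) * (1 / \<alpha>) powr g * D" "0 \<le> 1 / \<alpha> * D powr g"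
      using assms D0 by simp_all
    ultimately have AL: "A + (1 + T) * A powr g \<le> L * (D + D powr g)"
      using A by (simp add: L_def algebra_simps)
    have "H + 2 * c * (A + (1 + T) * A powr g) \<le> 1 / a0 * (D + D powr g) + 2 * c * (L * (D + D powr g))"
    proof (rule add_mono)
      have "1 / a0 * D \<le> 1 / a0 * (D + D powr g)" using assms by (intro mult_left_mono) auto
      then show "H \<le> 1 / a0 * (D + D powr g)" using H by linarith
      show "2 * c * (A + (1 + T) * A powr g) \<le> 2 * c * (L * (D + D powr g))"
        using AL assms by (intro mult_left_mono) auto
    qed
    then have "Q \<le> E * (1 / a0 * (D + D powr g) + 2 * c * (L * (D + D powr g)))"
      unfolding Q using assms by (intro mult_left_mono) auto
    then have QK: "Q \<le> K * (D + D powr g)" by (simp add: K_def algebra_simps)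
    \<comment> \<open>At time 0 the Gronwall bound closes on itself: q0 is on both sides.\<close>
    have "q0\<^sup>2 \<le> K * (p0 * q0 + (p0 * q0) powr g)" using qQ QK by (simp add: D_def)
    from absorb_product[OF nn(1,2) K0 g NN(1,2) this]
    have DS: "D + D powr g \<le> S * N\<^sup>2" by (simp add: D_def S_def)
    have QN: "Q \<le> K * S * N\<^sup>2"
      using QK mult_left_mono[OF DS K0] by (simp add: mult.assoc)
    have Q0: "0 \<le> Q" using qQ by (smt (verit) zero_le_power2)
    have sq: "N\<^sup>2 \<le> N'\<^sup>2" "(N powr g)\<^sup>2 \<le> N'\<^sup>2" "p0\<^sup>2 \<le> N'\<^sup>2"
      using NN N0 nn by (auto intro!: power_mono)
    have Qg: "Q powr g \<le> (K * S) powr g * N'\<^sup>2"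
    proof -
      have "Q powr g \<le> (K * S * N\<^sup>2) powr g" using QN Q0 g by (intro powr_mono2) auto
      also have "\<dots> = (K * S) powr g * (N powr g)\<^sup>2"
        using K0 S0 N0 by (simp add: powr_mult power2_eq_square)
      also have "\<dots> \<le> (K * S) powr g * N'\<^sup>2" using sq by (intro mult_left_mono) auto
      finally show ?thesis .
    qed
    have "A + (1 + T) * A powr g \<le> L * S * N'\<^sup>2"
    proof -
      have "A + (1 + T) * A powr g \<le> L * (S * N\<^sup>2)" using AL mult_left_mono[OF DS L0] by linarith
      also have "\<dots> \<le> L * (S * N'\<^sup>2)" using sq L0 S0 by (intro mult_left_mono) auto
      finally show ?thesis by simp
    qed
    moreover have "Q \<le> K * S * N'\<^sup>2"
      using QN sq(1) K0 S0 mult_left_mono[of "N\<^sup>2" "N'\<^sup>2" "K * S"] by simp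
    ultimately have "A + (1 + T) * A powr g + T * (Q + Q powr g)
        \<le> L * S * N'\<^sup>2 + T * (K * S * N'\<^sup>2 + (K * S) powr g * N'\<^sup>2)"
      using Qg assms by (intro add_mono mult_left_mono) auto
    then have "2 * c * (A + (1 + T) * A powr g + T * (Q + Q powr g))
        \<le> 2 * c * (L * S * N'\<^sup>2 + T * (K * S * N'\<^sup>2 + (K * S) powr g * N'\<^sup>2))"
      using assms by (intro mult_left_mono) auto
    then have "p0\<^sup>2 + 2 * c * (A + (1 + T) * A powr g + T * (Q + Q powr g)) \<le> R * N'\<^sup>2"
      using sq(3) by (simp add: R_def algebra_simps)
    also have "\<dots> \<le> C\<^sup>2 * N'\<^sup>2" using C by (intro mult_right_mono) auto
    moreover have "Q \<le> C\<^sup>2 * N\<^sup>2" using QN mult_right_mono[OF C(1), of "N\<^sup>2"] by simp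
    ultimately show ?thesis by (simp add: N_def N'_def power_mult_distrib)
  qed
  show ?thesis using C(3) main by (intro exI[of _ C]) blast
qed

context time_horizon
begin

text \<open>
  Jensen up to a constant, from \<open>y\<^sup>g \<le> 1 + y\<close> at \<open>y = P s / A\<close>. If \<open>A = 0\<close> then \<open>P\<close> vanishes almost everywhere.
\<close>

lemma integral_powr_le:
  fixes P :: "real \<Rightarrow> real"
  assumes P: "integrable \<L> P" "\<And>s. 0 \<le> P s" and g: "0 < g" "g \<le> 1"
  defines "A \<equiv> \<integral>s. P s \<partial>\<L>"
  shows "integrable \<L> (\<lambda>s. P s powr g)" "(\<integral>s. P s powr g \<partial>\<L>) \<le> (1 + T) * A powr g"
proof -
  have [measurable]: "P \<in> borel_measurable \<L>" using P by auto
  show i: "integrable \<L> (\<lambda>s. P s powr g)"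
  proof (rule Bochner_Integration.integrable_bound)
    show "integrable \<L> (\<lambda>s. 1 + P s)" using P by simp
    have "P s powr g \<le> 1 + P s" for s by (rule powr_le_one_plus[OF P(2) g])
    then show "AE s in \<L>. norm (P s powr g) \<le> norm (1 + P s)" using P(2) by simp
  qed simp
  have A0: "0 \<le> A" unfolding A_def using P(2) by simp
  show "(\<integral>s. P s powr g \<partial>\<L>) \<le> (1 + T) * A powr g"
  proof (cases "A = 0")
    case True
    then have "AE s in \<L>. P s = 0"
      using integral_nonneg_eq_0_iff_AE[OF P(1)] P(2) by (simp add: A_def)
    then have "AE s in \<L>. P s powr g = 0" by eventually_elim simp
    then have "(\<integral>s. P s powr g \<partial>\<L>) = (\<integral>s. 0 \<partial>\<L>)" by (intro integral_cong_AE) auto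
    then show ?thesis using True by simp
  next
    case False
    then have A: "0 < A" using A0 by simp
    have "P s powr g \<le> A powr g * (1 + P s / A)" for s
    proof -
      have "P s powr g = A powr g * (P s / A) powr g"
        using A P(2)[of s] by (subst powr_mult[symmetric]) auto
      also have "\<dots> \<le> A powr g * (1 + P s / A)"
        using A P(2)[of s] g by (intro mult_left_mono powr_le_one_plus) auto
      finally show ?thesis .
    qed
    then have "(\<integral>s. P s powr g \<partial>\<L>) \<le> (\<integral>s. A powr g * (1 + P s / A) \<partial>\<L>)"
      using i P by (intro integral_mono) auto
    also have "\<dots> = A powr g * (T + A / A)"
      using P T_pos measure_time_Icc[of 0 T] by (simp add: A_def)
    finally show ?thesis using A by (simp add: algebra_simps)
  qed
qed

text \<open>
  With the weight \<open>exp (2 k t)\<close> the integral term contributes at most half of the weighted supremum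
  \<open>S\<close>. The supremum is finite because the hypothesis, with the integral taken over all of \<open>[0,T]\<close>, already
  bounds \<open>\<psi>\<close>.
\<close>

lemma backward_Gronwall:
  fixes \<psi> :: "real \<Rightarrow> real"
  assumes \<psi>: "integrable \<L> \<psi>" "\<And>s. 0 \<le> \<psi> s" and k: "0 < k" and c: "0 \<le> c"
    and le: "\<And>t. t \<in> {0..T} \<Longrightarrow> \<psi> t \<le> c + k * (LINT s:{t..T}|\<L>. \<psi> s)"
    and t: "t \<in> {0..T}"
  shows "\<psi> t \<le> 2 * exp (2 * k * T) * c"
proof -
  define S where "S = (SUP t\<in>{0..T}. exp (2 * k * t) * \<psi> t)"
  have mono: "(LINT s:{t..T}|\<L>. \<psi> s) \<le> (\<integral>s. \<psi> s \<partial>\<L>)" if "t \<in> {0..T}" for t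
  proof -
    have "0 \<le> (LINT s:{0..t}|\<L>. \<psi> s)"
      unfolding set_lebesgue_integral_def by (intro Bochner_Integration.integral_nonneg) (use \<psi> in auto)
    then show ?thesis
      using set_integral_time_split[OF set_integrable_time[OF \<psi>(1)], of 0 T t] that by (simp add: set_integral_time_full)
  qed
  have bdd: "bdd_above ((\<lambda>t. exp (2 * k * t) * \<psi> t) ` {0..T})"
  proof (rule bdd_aboveI2)
    fix t assume t: "t \<in> {0..T}"
    have "\<psi> t \<le> c + k * (\<integral>s. \<psi> s \<partial>\<L>)"
      using le[OF t] mult_left_mono[OF mono[OF t], of k] k by linarith
    then show "exp (2 * k * t) * \<psi> t \<le> exp (2 * k * T) * (c + k * (\<integral>s. \<psi> s \<partial>\<L>))"
      using t k \<psi>(2)[of t] by (intro mult_mono) auto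
  qed
  have ub: "exp (2 * k * t) * \<psi> t \<le> S" if "t \<in> {0..T}" for t
    unfolding S_def by (rule cSUP_upper[OF that bdd])
  have S0: "0 \<le> S" using ub[of 0] \<psi>(2)[of 0] T_pos by simp
  have step: "exp (2 * k * t) * \<psi> t \<le> exp (2 * k * T) * c + S / 2" if t: "t \<in> {0..T}" for t
  proof -
    have deriv: "((\<lambda>s. - S / (2 * k) * exp (- (2 * k * s))) has_real_derivative S * exp (- (2 * k * s))) (at s)" for s
      using k by (auto intro!: derivative_eq_intros)
    have FTC: "has_bochner_integral lborel (\<lambda>s. S * exp (- (2 * k * s)) * indicator {t..T} s)
        (- S / (2 * k) * exp (- (2 * k * T)) - - S / (2 * k) * exp (- (2 * k * t)))"
      by (rule has_bochner_integral_FTC_Icc_real) (use t deriv in \<open>auto intro!: continuous_intros\<close>)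
    have eq: "(LINT s:{t..T}|\<L>. S * exp (- (2 * k * s)))
        = S / (2 * k) * exp (- (2 * k * t)) - S / (2 * k) * exp (- (2 * k * T))"
    proof -
      have "(LINT s:{t..T}|lborel. S * exp (- (2 * k * s)))
          = S / (2 * k) * exp (- (2 * k * t)) - S / (2 * k) * exp (- (2 * k * T))"
        using has_bochner_integral_integral_eq[OF FTC]
        unfolding set_lebesgue_integral_def real_scaleR_def by (simp only: mult.commute)
      then show ?thesis using t by (subst set_integral_time(1)[symmetric]) auto
    qed
    have si: "set_integrable \<L> {t..T} (\<lambda>s. S * exp (- (2 * k * s)))"
      using has_bochner_integral_iff[THEN iffD1, OF FTC] set_integral_time(2)[of t T "\<lambda>s. S * exp (- (2 * k * s))"] t
      by (simp add: set_integrable_def mult.commute)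
    have "(LINT s:{t..T}|\<L>. \<psi> s) \<le> (LINT s:{t..T}|\<L>. S * exp (- (2 * k * s)))"
    proof (rule set_integral_mono)
      fix s assume "s \<in> {t..T}"
      then have "exp (2 * k * s) * \<psi> s \<le> S" using t ub by auto
      then show "\<psi> s \<le> S * exp (- (2 * k * s))" by (simp add: exp_minus field_simps)
    qed (use t \<psi> si in \<open>auto intro!: set_integrable_time\<close>)
    also have "\<dots> \<le> S / (2 * k) * exp (- (2 * k * t))"
      unfolding eq using S0 k by simp
    finally have "k * (LINT s:{t..T}|\<L>. \<psi> s) \<le> S / 2 * exp (- (2 * k * t))"
      using k by (simp add: field_simps)
    then have "\<psi> t \<le> c + S / 2 * exp (- (2 * k * t))" using le[OF t] by linarith
    then have "exp (2 * k * t) * \<psi> t \<le> exp (2 * k * t) * (c + S / 2 * exp (- (2 * k * t)))" by simp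
    also have "\<dots> = exp (2 * k * t) * c + S / 2" by (simp add: exp_minus field_simps)
    also have "\<dots> \<le> exp (2 * k * T) * c + S / 2" using t k c by (intro add_mono mult_right_mono) auto
    finally show ?thesis .
  qed
  have "S \<le> exp (2 * k * T) * c + S / 2"
    unfolding S_def using T_pos by (intro cSUP_least) (use step S_def in auto)
  then have "S \<le> 2 * exp (2 * k * T) * c" by simp
  moreover have "\<psi> t \<le> exp (2 * k * t) * \<psi> t"
    using mult_right_mono[of 1 "exp (2 * k * t)" "\<psi> t"] t k \<psi>(2)[of t] by simp
  ultimately show ?thesis using ub[OF t] by linarith
qed

end

section \<open>Energy identities\<close>

text \<open>
  The difference of two solutions as seen through inner products: \<open>x\<close>, \<open>u\<close>, \<open>f\<close>, \<open>g\<close> stand for the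
  differences of \<open>X\<close>, \<open>W\<close>, \<open>F\<close>, \<open>G\<close> and \<open>h\<close> for that of the terminal conditions. The noise and the
  stochastic integrals have left no other trace than the restriction on the test variables in
  \<open>backward\<close>: they are those that are known at time \<open>t\<close>.
\<close>

locale coupled_system = time_horizon M T for M :: "'a measure" and T :: real +
  fixes x u f g :: "real \<Rightarrow> 'a \<Rightarrow> real^'d" and x0 h :: "'a \<Rightarrow> real^'d"
  assumes x: "process x" and u: "process u" and f: "process f" and g: "process g"
    and x0: "x0 \<in> L2_rv M" and h: "h \<in> L2_rv M"
    and forward: "\<And>t \<xi>. t \<in> {0..T} \<Longrightarrow> \<xi> \<in> L2_rv M \<Longrightarrow>
      L2_inner M \<xi> (x t) = L2_inner M \<xi> x0 - (LINT s:{0..t}|\<L>. L2_inner M \<xi> (f s))"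
    and backward: "\<And>t \<xi>. t \<in> {0..T} \<Longrightarrow> \<xi> \<in> {f t, g t, u t} \<or> t = 0 \<and> \<xi> = x0 \<Longrightarrow>
      L2_inner M \<xi> (u t) = L2_inner M \<xi> h + (LINT s:{t..T}|\<L>. L2_inner M \<xi> (g s))"
begin

text \<open>
  The integrated product rule \<open>d \<langle>x,u\<rangle> = - \<langle>f,u\<rangle> dt - \<langle>g,x\<rangle> dt\<close>. Testing \<open>u 0\<close> with \<open>x0\<close>, \<open>u s\<close> with
  \<open>f s\<close>, and \<open>x s\<close> with \<open>g s\<close> produces the kernel \<open>\<langle>f r, g s\<rangle>\<close> integrated over the triangle in both
  orders, and the two contributions cancel.
\<close>

lemma duality:
  "L2_inner M x0 (u 0) = L2_inner M (x T) h
     + (\<integral>s. L2_inner M (g s) (x s) + L2_inner M (f s) (u s) \<partial>\<L>)"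
proof -
  note V = x u f g process_const[OF x0] process_const[OF h]
  note I = process_inner_integrable
  have K: "integrable (\<L> \<Otimes>\<^sub>M \<L>) (\<lambda>(r, s). L2_inner M (f r) (g s))"
    by (rule process_kernel_integrable[OF f g])
  note F = triangle_Fubini[OF K order_refl order_refl, unfolded set_integral_time_full]
  have int1: "integrable \<L> (\<lambda>s. LINT r:{0..s}|\<L>. L2_inner M (f r) (g s))"
  proof -
    have "integrable \<L> (\<lambda>s. indicator {0..T} s *\<^sub>R (LINT r:{0..s}|\<L>. L2_inner M (f r) (g s)))"
      using F(2) by (simp add: set_integrable_def)
    then show ?thesis by (rule Bochner_Integration.integrable_cong[THEN iffD1, rotated 2]) auto
  qed
  have int2: "integrable \<L> (\<lambda>r. LINT s:{r..T}|\<L>. L2_inner M (f r) (g s))"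
  proof -
    have "integrable \<L> (\<lambda>r. indicator {0..T} r *\<^sub>R (LINT s:{r..T}|\<L>. L2_inner M (f r) (g s)))"
      using F(3) by (simp add: set_integrable_def)
    then show ?thesis by (rule Bochner_Integration.integrable_cong[THEN iffD1, rotated 2]) auto
  qed
  have T: "T \<in> {0..T}" "0 \<in> {0..T}" using T_pos by auto
  have xh: "L2_inner M (x T) h = L2_inner M x0 h - (\<integral>s. L2_inner M (f s) h \<partial>\<L>)"
    using forward[OF T(1) h] by (simp add: set_integral_time_full L2_inner_commute)
  have gx: "L2_inner M (g s) (x s) = L2_inner M x0 (g s) - (LINT r:{0..s}|\<L>. L2_inner M (f r) (g s))"
    if "s \<in> {0..T}" for s
    using forward[OF that processD(2)[OF g that]] by (simp add: L2_inner_commute)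
  have fu: "L2_inner M (f r) (u r) = L2_inner M (f r) h + (LINT s:{r..T}|\<L>. L2_inner M (f r) (g s))"
    if "r \<in> {0..T}" for r
    using backward[OF that, of "f r"] by simp
  have xu: "L2_inner M x0 (u 0) = L2_inner M x0 h + (\<integral>s. L2_inner M x0 (g s) \<partial>\<L>)"
    using backward[OF T(2), of x0] by (simp add: set_integral_time_full)
  have "(\<integral>s. L2_inner M (g s) (x s) + L2_inner M (f s) (u s) \<partial>\<L>)
     = (\<integral>s. L2_inner M (g s) (x s) \<partial>\<L>) + (\<integral>s. L2_inner M (f s) (u s) \<partial>\<L>)"
    by (intro Bochner_Integration.integral_add I V)
  also have "(\<integral>s. L2_inner M (g s) (x s) \<partial>\<L>)
     = (\<integral>s. L2_inner M x0 (g s) - (LINT r:{0..s}|\<L>. L2_inner M (f r) (g s)) \<partial>\<L>)"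
    by (intro Bochner_Integration.integral_cong refl gx) simp
  also have "\<dots> = (\<integral>s. L2_inner M x0 (g s) \<partial>\<L>) - (\<integral>s. (LINT r:{0..s}|\<L>. L2_inner M (f r) (g s)) \<partial>\<L>)"
    by (intro Bochner_Integration.integral_diff I V int1)
  also have "(\<integral>s. L2_inner M (f s) (u s) \<partial>\<L>)
     = (\<integral>s. L2_inner M (f s) h + (LINT r:{s..T}|\<L>. L2_inner M (f s) (g r)) \<partial>\<L>)"
    by (intro Bochner_Integration.integral_cong refl fu) simp
  also have "\<dots> = (\<integral>s. L2_inner M (f s) h \<partial>\<L>) + (\<integral>s. (LINT r:{s..T}|\<L>. L2_inner M (f s) (g r)) \<partial>\<L>)"
    by (intro Bochner_Integration.integral_add I V int2)
  finally show ?thesis using F(1) xh xu by simp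
qed

text \<open>
  Pairing \<open>x t\<close> with itself leaves the double integral of \<open>\<langle>f r, f s\<rangle>\<close> over a square, which is twice the one over
  the triangle \<open>r \<le> s\<close>; there it combines with \<open>\<langle>x0, f s\<rangle>\<close> to \<open>\<langle>x s, f s\<rangle>\<close>.
\<close>

lemma forward_energy:
  assumes t: "t \<in> {0..T}"
  shows "(L2_norm M (x t))\<^sup>2 = (L2_norm M x0)\<^sup>2 - 2 * (LINT s:{0..t}|\<L>. L2_inner M (f s) (x s))"
proof -
  define K where "K r s = L2_inner M (f r) (f s)" for r s
  have t': "0 \<le> (0::real)" "t \<le> T" using t by auto
  have xt: "x t \<in> L2_rv M" by (rule processD(2)[OF x t])
  have sI: "set_integrable \<L> {0..t} (\<lambda>s. L2_inner M x0 (f s))"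
    using t by (intro set_integrable_time process_inner_integrable process_const x0 f) auto
  note F = triangle_Fubini[OF process_kernel_integrable[OF f f] t', folded K_def]
  note S = square_Fubini_symmetric[OF f t', folded K_def]
  have sQ: "set_integrable \<L> {0..t} (\<lambda>s. LINT r:{0..t}|\<L>. K r s)"
  proof -
    have "set_integrable \<L> {0..t} (\<lambda>s. L2_inner M (\<lambda>\<omega>. LINT r:{0..t}|\<L>. f r \<omega>) (f s))"
      using t by (intro set_integrable_time process_inner_integrable f process_const time_integral_L2
          Icc_sets_time) auto
    moreover have "L2_inner M (\<lambda>\<omega>. LINT r:{0..t}|\<L>. f r \<omega>) (f s) = (LINT r:{0..t}|\<L>. K r s)"
      if "s \<in> {0..t}" for s
      using inner_time_integral[OF f processD(2)[OF f], of s "{0..t}"] that t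
      by (simp add: K_def L2_inner_commute[of M _ "f s"] Icc_sets_time)
    ultimately show ?thesis
      by (subst set_integrable_cong[OF refl refl]) auto
  qed
  have 1: "(L2_norm M (x t))\<^sup>2 = L2_inner M x0 (x t) - (LINT s:{0..t}|\<L>. L2_inner M (f s) (x t))"
    using forward[OF t xt] by (simp add: L2_norm_sq L2_inner_commute)
  have 2: "L2_inner M x0 (x t) = (L2_norm M x0)\<^sup>2 - (LINT s:{0..t}|\<L>. L2_inner M x0 (f s))"
    using forward[OF t x0] by (simp add: L2_norm_sq)
  have 3: "(LINT s:{0..t}|\<L>. L2_inner M (f s) (x t))
      = (LINT s:{0..t}|\<L>. L2_inner M x0 (f s)) - (LINT s:{0..t}|\<L>. LINT r:{0..t}|\<L>. K r s)"
    by (subst set_integral_diff(2)[OF sI sQ, symmetric], intro set_lebesgue_integral_cong)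
       (use t forward[OF t processD(2)[OF f]] in
         \<open>auto simp: Icc_sets_time K_def L2_inner_commute\<close>)
  have 4: "(LINT s:{0..t}|\<L>. L2_inner M (f s) (x s))
      = (LINT s:{0..t}|\<L>. L2_inner M x0 (f s)) - (LINT s:{0..t}|\<L>. LINT r:{0..s}|\<L>. K r s)"
    by (subst set_integral_diff(2)[OF sI F(2), symmetric], intro set_lebesgue_integral_cong)
       (use t forward[OF _ processD(2)[OF f]] in
         \<open>auto simp: Icc_sets_time K_def L2_inner_commute\<close>)
  show ?thesis unfolding 1 2 3 4 S(1) by simp
qed

text \<open>
  With \<open>S = h + \<integral>\<^sub>t\<^sup>T g\<close>, testing with \<open>u t\<close> gives \<open>|u t|\<^sup>2 = \<langle>u t, S\<rangle>\<close>, so the norm of \<open>u t\<close> is at most that of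
  \<open>S\<close>, as for a conditional expectation. In the square of \<open>S\<close> the double integral of \<open>\<langle>g r, g s\<rangle>\<close> over the square is twice that
  over the triangle \<open>s \<le> r\<close>, where \<open>\<langle>h, g s\<rangle> + \<integral>\<^sub>s\<^sup>T \<langle>g r, g s\<rangle> dr\<close> is \<open>\<langle>u s, g s\<rangle>\<close> by the backward relation for \<open>u s\<close>.
\<close>

lemma backward_energy:
  assumes t: "t \<in> {0..T}"
  shows "(L2_norm M (u t))\<^sup>2 \<le> (L2_norm M h)\<^sup>2 + 2 * (LINT s:{t..T}|\<L>. L2_inner M (g s) (u s))"
proof -
  define K where "K r s = L2_inner M (g r) (g s)" for r s
  define R where "R = (\<lambda>\<omega>. LINT s:{t..T}|\<L>. g s \<omega>)"
  define S where "S = (\<lambda>\<omega>. h \<omega> + R \<omega>)"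
  have t': "0 \<le> t" "T \<le> T" using t by auto
  have tT: "{t..T} \<in> sets \<L>" using t by (intro Icc_sets_time) auto
  have R: "R \<in> L2_rv M" unfolding R_def by (rule time_integral_L2[OF g tT])
  have S: "S \<in> L2_rv M" unfolding S_def by (rule L2_rv_add[OF h R])
  have ut: "u t \<in> L2_rv M" by (rule processD(2)[OF u t])
  have inner_S: "L2_inner M \<xi> S = L2_inner M \<xi> h + (LINT s:{t..T}|\<L>. L2_inner M \<xi> (g s))"
    if "\<xi> \<in> L2_rv M" for \<xi>
    unfolding S_def using L2_inner_add_right[OF that h R] inner_time_integral[OF g that tT]
    by (simp add: R_def)
  have sI: "set_integrable \<L> {t..T} (\<lambda>s. L2_inner M h (g s))"
    using t by (intro set_integrable_time process_inner_integrable process_const h g) auto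
  note F = triangle_Fubini[OF process_kernel_integrable[OF g g] t', folded K_def]
  note Q = square_Fubini_symmetric[OF g t', folded K_def]
  have K_sym: "K r s = K s r" for r s by (simp add: K_def L2_inner_commute)
  have RK: "L2_inner M R (g s) = (LINT r:{t..T}|\<L>. K r s)" if "s \<in> {t..T}" for s
    using inner_time_integral[OF g processD(2)[OF g], of s "{t..T}"] that t tT
    by (simp add: R_def K_def L2_inner_commute[of M _ "g s"])
  have sQ: "set_integrable \<L> {t..T} (\<lambda>s. LINT r:{t..T}|\<L>. K r s)"
  proof -
    have "set_integrable \<L> {t..T} (\<lambda>s. L2_inner M R (g s))"
      using t by (intro set_integrable_time process_inner_integrable g process_const R) auto
    with RK show ?thesis by (subst set_integrable_cong[OF refl refl]) auto
  qed
  have "(L2_norm M (u t))\<^sup>2 = L2_inner M (u t) S"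
    using backward[OF t, of "u t"] inner_S[OF ut] by (simp add: L2_norm_sq)
  also have "\<dots> \<le> L2_norm M (u t) * L2_norm M S" using L2_Cauchy_Schwarz[OF ut S] by simp
  finally have "L2_norm M (u t) * L2_norm M (u t) \<le> L2_norm M (u t) * L2_norm M S"
    by (simp add: power2_eq_square)
  then have "L2_norm M (u t) \<le> L2_norm M S"
    by (cases "L2_norm M (u t) = 0") (auto simp: mult_le_cancel_left less_le)
  then have "(L2_norm M (u t))\<^sup>2 \<le> (L2_norm M S)\<^sup>2" by (intro power_mono) auto
  also have "\<dots> = L2_inner M h S + (LINT s:{t..T}|\<L>. L2_inner M (g s) S)"
    using inner_S[OF S] by (simp add: L2_norm_sq L2_inner_commute)
  also have "L2_inner M h S = (L2_norm M h)\<^sup>2 + (LINT s:{t..T}|\<L>. L2_inner M h (g s))"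
    using inner_S[OF h] by (simp add: L2_norm_sq)
  also have "(LINT s:{t..T}|\<L>. L2_inner M (g s) S)
      = (LINT s:{t..T}|\<L>. L2_inner M h (g s)) + (LINT s:{t..T}|\<L>. LINT r:{t..T}|\<L>. K r s)"
    by (subst set_integral_add(2)[OF sI sQ, symmetric], intro set_lebesgue_integral_cong)
       (use t inner_S[OF processD(2)[OF g]] in
         \<open>auto simp: Icc_sets_time K_def L2_inner_commute\<close>)
  finally have 1: "(L2_norm M (u t))\<^sup>2 \<le> (L2_norm M h)\<^sup>2 + 2 * (LINT s:{t..T}|\<L>. L2_inner M h (g s))
      + (LINT s:{t..T}|\<L>. LINT r:{t..T}|\<L>. K r s)" by simp
  have sF: "set_integrable \<L> {t..T} (\<lambda>s. LINT r:{s..T}|\<L>. K r s)"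
    using F(3) by (simp only: K_sym)
  have "(LINT s:{t..T}|\<L>. L2_inner M (g s) (u s))
      = (LINT s:{t..T}|\<L>. L2_inner M h (g s)) + (LINT s:{t..T}|\<L>. LINT r:{s..T}|\<L>. K r s)"
    by (subst set_integral_add(2)[OF sI sF, symmetric], intro set_lebesgue_integral_cong)
       (use t backward in \<open>auto simp: Icc_sets_time K_def L2_inner_commute\<close>)
  then show ?thesis using 1 unfolding Q(2) by simp
qed

text \<open>
  Monotonicity in \<open>duality\<close> bounds \<open>H\<close> and \<open>A\<close> by the product of the two initial norms; the one-sided
  bound on \<open>g\<close> in \<open>backward_energy\<close> gives the second estimate by Gronwall. The forward estimate needs no
  Gronwall argument, because \<open>x\<close> enters its right side through \<open>A\<close> alone.
\<close>

lemma stability: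
  fixes \<alpha> a0 c \<gamma> :: real
  assumes c: "0 \<le> c" and \<gamma>: "0 < \<gamma>" "\<gamma> \<le> 1"
    and m1: "a0 * (L2_norm M h)\<^sup>2 \<le> L2_inner M h (x T)"
    and m2: "\<And>s. s \<in> {0..T} \<Longrightarrow>
      \<alpha> * (L2_norm M (x s))\<^sup>2 \<le> L2_inner M (g s) (x s) + L2_inner M (f s) (u s)"
    and m3: "\<And>s. s \<in> {0..T} \<Longrightarrow>
      L2_inner M (g s) (u s) \<le> c * ((L2_norm_exp M \<gamma> (x s))\<^sup>2 + (L2_norm M (u s))\<^sup>2)"
    and m4: "\<And>s. s \<in> {0..T} \<Longrightarrow>
      - c * ((L2_norm_exp M \<gamma> (x s))\<^sup>2 + (L2_norm_exp M \<gamma> (u s))\<^sup>2) \<le> L2_inner M (f s) (x s)"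
  defines "A \<equiv> \<integral>s. (L2_norm M (x s))\<^sup>2 \<partial>\<L>"
    and "H \<equiv> (L2_norm M h)\<^sup>2"
  shows "a0 * H + \<alpha> * A \<le> L2_norm M x0 * L2_norm M (u 0)"
    and "t \<in> {0..T} \<Longrightarrow> (L2_norm M (u t))\<^sup>2
      \<le> 2 * exp (2 * (2 * c + 1) * T) * (H + 2 * c * (A + (1 + T) * A powr \<gamma>))"
    and "t \<in> {0..T} \<Longrightarrow> (\<And>s. s \<in> {0..T} \<Longrightarrow> (L2_norm M (u s))\<^sup>2 \<le> q) \<Longrightarrow> (L2_norm M (x t))\<^sup>2
      \<le> (L2_norm M x0)\<^sup>2 + 2 * c * (A + (1 + T) * A powr \<gamma> + T * (q + q powr \<gamma>))"
proof -
  define P where "P s = (L2_norm M (x s))\<^sup>2" for s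
  define \<psi> where "\<psi> s = (L2_norm M (u s))\<^sup>2" for s
  note I = process_inner_integrable
  have T0: "0 \<in> {0..T}" "T \<in> {0..T}" using T_pos by auto
  have iP: "integrable \<L> P" and i\<psi>: "integrable \<L> \<psi>"
    unfolding P_def \<psi>_def L2_norm_sq using I x u by auto
  have P0: "0 \<le> P s" and \<psi>0: "0 \<le> \<psi> s" for s by (simp_all add: P_def \<psi>_def)
  note iPg = integral_powr_le[OF iP P0 \<gamma>]
  have A: "A = (\<integral>s. P s \<partial>\<L>)" by (simp add: A_def P_def)
  have A0: "0 \<le> A" unfolding A using P0 by simp
  have Pg: "(LINT s:{a..b}|\<L>. P s + P s powr \<gamma>) \<le> A + (1 + T) * A powr \<gamma>"
    if "0 \<le> a" "b \<le> T" for a b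
  proof -
    have "(LINT s:{a..b}|\<L>. P s + P s powr \<gamma>) \<le> (\<integral>s. P s + P s powr \<gamma> \<partial>\<L>)"
      unfolding set_lebesgue_integral_def
    proof (rule integral_mono)
      show "integrable \<L> (\<lambda>s. indicator {a..b} s *\<^sub>R (P s + P s powr \<gamma>))"
        using iP iPg(1) Icc_sets_time[OF that] by (intro integrable_mult_indicator) auto
    qed (use iP iPg(1) P0 in \<open>auto simp: indicator_def\<close>)
    then show ?thesis using iP iPg A by simp
  qed
  have n: "(L2_norm_exp M \<gamma> (x s))\<^sup>2 \<le> P s + P s powr \<gamma>" for s
    unfolding L2_norm_exp_def P_def by (rule max_powr_sq_le) simp
  have n': "(L2_norm_exp M \<gamma> (u s))\<^sup>2 \<le> \<psi> s + \<psi> s powr \<gamma>" for s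
    unfolding L2_norm_exp_def \<psi>_def by (rule max_powr_sq_le) simp
  show "a0 * H + \<alpha> * A \<le> L2_norm M x0 * L2_norm M (u 0)"
  proof -
    have "\<alpha> * A = (\<integral>s. \<alpha> * P s \<partial>\<L>)" by (simp add: A)
    also have "\<dots> \<le> (\<integral>s. L2_inner M (g s) (x s) + L2_inner M (f s) (u s) \<partial>\<L>)"
      using m2 by (intro integral_mono Bochner_Integration.integrable_add I x u f g integrable_mult_right iP)
        (auto simp: P_def)
    finally have "a0 * H + \<alpha> * A \<le> L2_inner M x0 (u 0)"
      using duality m1 by (simp add: H_def L2_inner_commute)
    also have "\<dots> \<le> L2_norm M x0 * L2_norm M (u 0)"
      using L2_Cauchy_Schwarz[OF x0 processD(2)[OF u T0(1)]] by simp
    finally show ?thesis .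
  qed
  have pre_Gronwall: "\<psi> t \<le> (H + 2 * c * (A + (1 + T) * A powr \<gamma>)) + (2 * c + 1) * (LINT s:{t..T}|\<L>. \<psi> s)"
    if t: "t \<in> {0..T}" for t
  proof -
    have si: "set_integrable \<L> {t..T} \<psi>" "set_integrable \<L> {t..T} (\<lambda>s. P s + P s powr \<gamma>)"
      using t iP i\<psi> iPg(1) by (auto intro!: set_integrable_time)
    have "(LINT s:{t..T}|\<L>. L2_inner M (g s) (u s)) \<le> (LINT s:{t..T}|\<L>. c * ((P s + P s powr \<gamma>) + \<psi> s))"
    proof (rule set_integral_mono)
      show "set_integrable \<L> {t..T} (\<lambda>s. L2_inner M (g s) (u s))"
        using t by (intro set_integrable_time I g u) auto
      show "set_integrable \<L> {t..T} (\<lambda>s. c * ((P s + P s powr \<gamma>) + \<psi> s))"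
        using t iP i\<psi> iPg(1)
        by (intro set_integrable_time integrable_mult_right Bochner_Integration.integrable_add) auto
      fix s assume "s \<in> {t..T}"
      then have "L2_inner M (g s) (u s) \<le> c * ((L2_norm_exp M \<gamma> (x s))\<^sup>2 + \<psi> s)"
        using m3[of s] t by (simp add: \<psi>_def)
      also have "\<dots> \<le> c * ((P s + P s powr \<gamma>) + \<psi> s)"
        using n c by (intro mult_left_mono add_mono) auto
      finally show "L2_inner M (g s) (u s) \<le> c * ((P s + P s powr \<gamma>) + \<psi> s)" .
    qed
    also have "\<dots> = c * ((LINT s:{t..T}|\<L>. P s + P s powr \<gamma>) + (LINT s:{t..T}|\<L>. \<psi> s))"
      using set_integral_add(2)[OF si(2,1)] by simp
    also have "\<dots> \<le> c * ((A + (1 + T) * A powr \<gamma>) + (LINT s:{t..T}|\<L>. \<psi> s))"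
      using c Pg t by (intro mult_left_mono add_right_mono) auto
    finally have "\<psi> t \<le> H + 2 * (c * ((A + (1 + T) * A powr \<gamma>) + (LINT s:{t..T}|\<L>. \<psi> s)))"
      using backward_energy[OF t] by (simp add: \<psi>_def H_def)
    moreover have "0 \<le> (LINT s:{t..T}|\<L>. \<psi> s)"
      unfolding set_lebesgue_integral_def by (intro Bochner_Integration.integral_nonneg) (use \<psi>0 in auto)
    ultimately show ?thesis by (simp add: algebra_simps)
  qed
  show "(L2_norm M (u t))\<^sup>2
      \<le> 2 * exp (2 * (2 * c + 1) * T) * (H + 2 * c * (A + (1 + T) * A powr \<gamma>))" if "t \<in> {0..T}"
    unfolding \<psi>_def[symmetric]
    by (rule backward_Gronwall[OF i\<psi> \<psi>0 _ _ pre_Gronwall that]) (use c A0 T_pos in \<open>auto simp: H_def\<close>)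
  show "(L2_norm M (x t))\<^sup>2
      \<le> (L2_norm M x0)\<^sup>2 + 2 * c * (A + (1 + T) * A powr \<gamma> + T * (q + q powr \<gamma>))"
    if t: "t \<in> {0..T}" and q: "\<And>s. s \<in> {0..T} \<Longrightarrow> (L2_norm M (u s))\<^sup>2 \<le> q"
  proof -
    have q0: "0 \<le> q" using q[OF T0(1)] by (smt (verit) zero_le_power2)
    have si: "set_integrable \<L> {0..t} (\<lambda>s. P s + P s powr \<gamma>)" "set_integrable \<L> {0..t} (\<lambda>s. q + q powr \<gamma>)"
      using t iP iPg(1) by (auto intro!: set_integrable_time)
    have "- (LINT s:{0..t}|\<L>. L2_inner M (f s) (x s)) = (LINT s:{0..t}|\<L>. - L2_inner M (f s) (x s))"
      by (simp add: set_lebesgue_integral_def)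
    also have "\<dots> \<le> (LINT s:{0..t}|\<L>. c * ((P s + P s powr \<gamma>) + (q + q powr \<gamma>)))"
    proof (rule set_integral_mono)
      show "set_integrable \<L> {0..t} (\<lambda>s. - L2_inner M (f s) (x s))"
        using t by (intro set_integrable_time Bochner_Integration.integrable_minus I f x) auto
      show "set_integrable \<L> {0..t} (\<lambda>s. c * ((P s + P s powr \<gamma>) + (q + q powr \<gamma>)))"
        using t iP iPg(1)
        by (intro set_integrable_time integrable_mult_right Bochner_Integration.integrable_add) auto
      fix s assume s: "s \<in> {0..t}"
      then have "\<psi> s \<le> q" using q[of s] t by (simp add: \<psi>_def)
      moreover from this have "\<psi> s powr \<gamma> \<le> q powr \<gamma>" using \<psi>0 \<gamma> by (intro powr_mono2) auto
      ultimately have "(L2_norm_exp M \<gamma> (x s))\<^sup>2 + (L2_norm_exp M \<gamma> (u s))\<^sup>2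
          \<le> (P s + P s powr \<gamma>) + (q + q powr \<gamma>)"
        using n[of s] n'[of s] by linarith
      from mult_left_mono[OF this c] show "- L2_inner M (f s) (x s) \<le> c * ((P s + P s powr \<gamma>) + (q + q powr \<gamma>))"
        using m4[of s] s t by simp
    qed
    also have "\<dots> = c * ((LINT s:{0..t}|\<L>. P s + P s powr \<gamma>) + (LINT s:{0..t}|\<L>. q + q powr \<gamma>))"
      using set_integral_add(2)[OF si] by simp
    also have "(LINT s:{0..t}|\<L>. q + q powr \<gamma>) = t * (q + q powr \<gamma>)"
      using t measure_time_Icc[of 0 t] Icc_sets_time[of 0 t] by (simp add: set_lebesgue_integral_def)
    also have "c * ((LINT s:{0..t}|\<L>. P s + P s powr \<gamma>) + t * (q + q powr \<gamma>))
        \<le> c * ((A + (1 + T) * A powr \<gamma>) + T * (q + q powr \<gamma>))"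
      using c Pg t q0 by (intro mult_left_mono add_mono mult_right_mono) auto
    finally show ?thesis using forward_energy[OF t] by (simp add: algebra_simps)
  qed
qed

end

section \<open>Brownian increments and the Ito integral\<close>

lemma measurable_vec_nth [measurable]: "(\<lambda>x::'b::{second_countable_topology,topological_space}^'n. x $ i) \<in> borel_measurable borel"
  by (intro borel_measurable_continuous_onI continuous_intros)

lemma filtered_spaceD:
  assumes "filtered_space M Ft"
  shows "f \<in> measurable (Ft t) N \<Longrightarrow> f \<in> measurable M N"
    and "s \<le> t \<Longrightarrow> f \<in> measurable (Ft s) N \<Longrightarrow> f \<in> measurable (Ft t) N"
    and "space (Ft t) = space M"
proof -
  have sub: "subalgebra M (Ft t)" for t using assms by (simp add: filtered_space_def)
  show "f \<in> measurable (Ft t) N \<Longrightarrow> f \<in> measurable M N" by (rule measurable_from_subalg[OF sub])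
  show sp: "space (Ft t) = space M" for t using sub by (simp add: subalgebra_def)
  interpret filtration "space M" Ft using assms by (simp add: filtered_space_def)
  show "f \<in> measurable (Ft t) N" if "s \<le> t" "f \<in> measurable (Ft s) N"
    by (rule measurable_from_subalg[OF _ that(2)])
       (use sets_F_mono[OF that(1)] in \<open>simp add: subalgebra_def sp\<close>)
qed

locale brownian = prob_space M for M :: "'a measure" +
  fixes Ft :: "real \<Rightarrow> 'a measure" and B :: "real \<Rightarrow> 'a \<Rightarrow> real^'d"
  assumes filtered: "filtered_space M Ft" and bm: "brownian_motion M Ft B"
begin

lemma B_measurable [measurable]: "0 \<le> t \<Longrightarrow> B t \<in> borel_measurable M"
  using bm by (auto simp: brownian_motion_def intro: filtered_spaceD(1)[OF filtered])

lemma increment_distributed: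
  assumes "0 \<le> s" "s < t"
  shows "distributed M lborel (\<lambda>\<omega>. (B t \<omega> - B s \<omega>) $ i) (normal_density 0 (sqrt (t - s)))"
  using bm assms unfolding brownian_motion_def by blast

lemma increment_integrable:
  assumes st: "0 \<le> s" "s \<le> t"
  shows "integrable M (\<lambda>\<omega>. ((B t \<omega> - B s \<omega>) $ i) ^ k)"
proof (cases "s = t")
  case True then show ?thesis by simp
next
  case False
  then have st': "s < t" using st by simp
  have "integrable lborel (\<lambda>x. normal_density 0 (sqrt (t - s)) x * (x - 0) ^ k)"
    using st' by (intro integrable_normal_moment) simp
  then show ?thesis
    using distributed_integrable[OF increment_distributed[OF st(1) st'], of "\<lambda>x. x ^ k" i] by simp
qed

lemma increment_mean:
  assumes st: "0 \<le> s" "s \<le> t"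
  shows "expectation (\<lambda>\<omega>. (B t \<omega> - B s \<omega>) $ i) = 0"
  using normal_distributed_expectation[OF _ increment_distributed[OF st(1)], of t i] st
  by (cases "s = t") auto

lemma increment_second_moment:
  assumes st: "0 \<le> s" "s \<le> t"
  shows "integrable M (\<lambda>\<omega>. (norm (B t \<omega> - B s \<omega>))\<^sup>2)"
    and "expectation (\<lambda>\<omega>. (norm (B t \<omega> - B s \<omega>))\<^sup>2) = real CARD('d) * (t - s)"
proof -
  have eq: "(norm (B t \<omega> - B s \<omega>))\<^sup>2 = (\<Sum>i\<in>UNIV. ((B t \<omega> - B s \<omega>) $ i)\<^sup>2)" for \<omega>
    unfolding power2_norm_eq_inner inner_vec_def by (simp add: power2_eq_square)
  note int = increment_integrable[OF st, of _ 2]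
  show "integrable M (\<lambda>\<omega>. (norm (B t \<omega> - B s \<omega>))\<^sup>2)"
    unfolding eq by (intro Bochner_Integration.integrable_sum int)
  have "expectation (\<lambda>\<omega>. ((B t \<omega> - B s \<omega>) $ i)\<^sup>2) = t - s" for i
    using normal_distributed_variance[OF _ increment_distributed[OF st(1)], of t i]
      increment_mean[OF st, of i] st
    by (cases "s = t") auto
  then show "expectation (\<lambda>\<omega>. (norm (B t \<omega> - B s \<omega>))\<^sup>2) = real CARD('d) * (t - s)"
    unfolding eq using int by (simp add: Bochner_Integration.integral_sum del: vector_minus_component)
qed

text \<open>
  The increment is independent of \<open>Ft s\<close> and has mean zero. Its independence passes from the whole vector
  to a coordinate because the events of the coordinate are among those of the vector.
\<close>

lemma increment_orthogonal:
  fixes \<eta> :: "'a \<Rightarrow> real"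
  assumes st: "0 \<le> s" "s \<le> t" and \<eta>: "\<eta> \<in> borel_measurable (Ft s)" "integrable M \<eta>"
  shows "integrable M (\<lambda>\<omega>. \<eta> \<omega> * (B t \<omega> - B s \<omega>) $ i)"
    and "expectation (\<lambda>\<omega>. \<eta> \<omega> * (B t \<omega> - B s \<omega>) $ i) = 0"
proof -
  have "integrable M (\<lambda>\<omega>. \<eta> \<omega> * (B t \<omega> - B s \<omega>) $ i) \<and>
    expectation (\<lambda>\<omega>. \<eta> \<omega> * (B t \<omega> - B s \<omega>) $ i) = 0"
  proof (cases "s = t")
    case True then show ?thesis by simp
  next
    case False
    then have st': "s < t" using st by simp
    let ?D = "\<lambda>\<omega>. B t \<omega> - B s \<omega>"
    have [measurable]: "?D \<in> borel_measurable M" using st by simp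
    have indep: "indep_set (sets (Ft s)) {?D -` A \<inter> space M | A. A \<in> sets borel}"
      using bm st(1) st' unfolding brownian_motion_def by blast
    have 1: "sigma_sets (space M) {\<eta> -` A \<inter> space M | A. A \<in> sets borel} \<subseteq> sets (Ft s)"
      using sets.sigma_sets_subset[of "{\<eta> -` A \<inter> space M | A. A \<in> sets borel}" "Ft s"]
        measurable_sets[OF \<eta>(1)] filtered_spaceD(3)[OF filtered, of s] by auto
    have "sigma_sets (space M) {(\<lambda>\<omega>. ?D \<omega> $ i) -` A \<inter> space M | A. A \<in> sets borel}
        = {(\<lambda>\<omega>. ?D \<omega> $ i) -` A \<inter> space M | A. A \<in> sets borel}"
      using sigma_sets_vimage_commute[of "\<lambda>\<omega>. ?D \<omega> $ i" "space M" UNIV "sets borel"]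
        sets.sigma_sets_eq[of "borel :: real measure"] by simp
    also have "\<dots> \<subseteq> {?D -` A \<inter> space M | A. A \<in> sets borel}"
    proof clarify
      fix A :: "real set" assume A: "A \<in> sets borel"
      have "(\<lambda>x::real^'d. x $ i) -` A \<inter> space borel \<in> sets borel"
        by (rule measurable_sets[OF measurable_vec_nth A])
      moreover have "(\<lambda>\<omega>. ?D \<omega> $ i) -` A \<inter> space M = ?D -` ((\<lambda>x. x $ i) -` A \<inter> space borel) \<inter> space M"
        by auto
      ultimately show "\<exists>A'. (\<lambda>\<omega>. ?D \<omega> $ i) -` A \<inter> space M = ?D -` A' \<inter> space M \<and> A' \<in> sets borel"
        by blast
    qed
    finally have 2: "sigma_sets (space M) {(\<lambda>\<omega>. ?D \<omega> $ i) -` A \<inter> space M | A. A \<in> sets borel}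
        \<subseteq> {?D -` A \<inter> space M | A. A \<in> sets borel}" .
    have rv: "random_variable borel \<eta>" "random_variable borel (\<lambda>\<omega>. ?D \<omega> $ i)"
      using filtered_spaceD(1)[OF filtered \<eta>(1)] by measurable
    have "indep_set (sigma_sets (space M) {\<eta> -` A \<inter> space M | A. A \<in> sets borel})
        (sigma_sets (space M) {(\<lambda>\<omega>. ?D \<omega> $ i) -` A \<inter> space M | A. A \<in> sets borel})"
    proof (rule indep_setI)
      show "sigma_sets (space M) {\<eta> -` A \<inter> space M | A. A \<in> sets borel} \<subseteq> events"
        using order_trans[OF 1 indep_setD_ev1[OF indep]] .
      show "sigma_sets (space M) {(\<lambda>\<omega>. ?D \<omega> $ i) -` A \<inter> space M | A. A \<in> sets borel} \<subseteq> events"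
        using order_trans[OF 2 indep_setD_ev2[OF indep]] .
      fix a b
      assume "a \<in> sigma_sets (space M) {\<eta> -` A \<inter> space M | A. A \<in> sets borel}"
        "b \<in> sigma_sets (space M) {(\<lambda>\<omega>. ?D \<omega> $ i) -` A \<inter> space M | A. A \<in> sets borel}"
      then show "prob (a \<inter> b) = prob a * prob b"
        by (intro indep_setD[OF indep] subsetD[OF 1] subsetD[OF 2])
    qed
    then have iv: "indep_var borel \<eta> borel (\<lambda>\<omega>. ?D \<omega> $ i)"
      using rv by (simp only: indep_var_eq)
    have int: "integrable M (\<lambda>\<omega>. ?D \<omega> $ i)" using increment_integrable[OF st, of i 1] by simp
    show ?thesis
      using indep_var_integrable[OF iv \<eta>(2) int] indep_var_lebesgue_integral[OF iv \<eta>(2) int]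
        increment_mean[OF st, of i] by simp
  qed
  then show "integrable M (\<lambda>\<omega>. \<eta> \<omega> * (B t \<omega> - B s \<omega>) $ i)"
    "expectation (\<lambda>\<omega>. \<eta> \<omega> * (B t \<omega> - B s \<omega>) $ i) = 0" by auto
qed

text \<open>
  All partition points are at least \<open>s\<close>, so \<open>\<xi>\<close> is known at each of them. The pairing is a finite
  combination of terms \<open>\<eta> i j k\<close> times a coordinate of an increment, where \<open>\<eta> i j k\<close> is integrable, as \<open>Z\<close> is
  bounded, and known when the increment starts.
\<close>

lemma simple_integral_orthogonal:
  fixes \<xi> :: "'a \<Rightarrow> real^'d" and Z :: "nat \<Rightarrow> 'a \<Rightarrow> real^'d^'d"
  assumes s: "0 \<le> s" and si: "simple_integrand M Ft s t n \<tau> Z"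
    and \<xi>: "\<xi> \<in> L2_rv M" "\<xi> \<in> borel_measurable (Ft s)"
  shows "simple_integral B n \<tau> Z \<in> borel_measurable M"
    and "integrable M (\<lambda>\<omega>. \<xi> \<omega> \<bullet> simple_integral B n \<tau> Z \<omega>)"
    and "expectation (\<lambda>\<omega>. \<xi> \<omega> \<bullet> simple_integral B n \<tau> Z \<omega>) = 0"
proof -
  have step: "\<tau> i \<le> \<tau> (Suc i)" "Z i \<in> borel_measurable (Ft (\<tau> i))" "bounded (Z i ` space M)"
    if "i < n" for i using si that by (auto simp: simple_integrand_def)
  have ge: "i \<le> n \<Longrightarrow> s \<le> \<tau> i" for i
  proof (induction i)
    case 0 then show ?case using si by (simp add: simple_integrand_def)
  next
    case (Suc i) then show ?case using step(1)[of i] by simp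
  qed
  have ge0: "0 \<le> \<tau> i" if "i \<le> n" for i using ge[OF that] s by simp
  define \<eta> where "\<eta> i j k \<omega> = \<xi> \<omega> $ k * Z i \<omega> $ k $ j" for i j k \<omega>
  have \<eta>m: "\<eta> i j k \<in> borel_measurable (Ft (\<tau> i))" if "i < n" for i j k
  proof -
    have [measurable]: "Z i \<in> borel_measurable (Ft (\<tau> i))" "\<xi> \<in> borel_measurable (Ft (\<tau> i))"
      using step(2)[OF that] filtered_spaceD(2)[OF filtered ge \<xi>(2)] that by auto
    show ?thesis unfolding \<eta>_def by measurable
  qed
  have \<eta>i: "integrable M (\<eta> i j k)" if i: "i < n" for i j k
  proof -
    obtain b where b: "\<And>\<omega>. \<omega> \<in> space M \<Longrightarrow> norm (Z i \<omega>) \<le> b"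
      using step(3)[OF i] by (auto simp: bounded_iff)
    have "integrable M \<xi>" using \<xi>(1) unfolding L2_rv_eq by (rule integrable_square_integrable)
    then have bound: "integrable M (\<lambda>\<omega>. b * norm (\<xi> \<omega>))" by simp
    show ?thesis
    proof (rule Bochner_Integration.integrable_bound[OF bound])
      show "\<eta> i j k \<in> borel_measurable M" using filtered_spaceD(1)[OF filtered \<eta>m[OF that]] .
      show "AE \<omega> in M. norm (\<eta> i j k \<omega>) \<le> norm (b * norm (\<xi> \<omega>))"
      proof (rule AE_I2)
        fix \<omega> assume \<omega>: "\<omega> \<in> space M"
        have "\<bar>Z i \<omega> $ k $ j\<bar> \<le> norm (Z i \<omega> $ k)" by (rule component_le_norm_cart)
        also have "\<dots> \<le> norm (Z i \<omega>)" by (rule Finite_Cartesian_Product.norm_nth_le)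
        also have "\<dots> \<le> b" by (rule b[OF \<omega>])
        finally have 1: "\<bar>Z i \<omega> $ k $ j\<bar> \<le> b" .
        then have "\<bar>Z i \<omega> $ k $ j\<bar> * \<bar>\<xi> \<omega> $ k\<bar> \<le> b * norm (\<xi> \<omega>)"
          by (intro mult_mono component_le_norm_cart) auto
        then show "norm (\<eta> i j k \<omega>) \<le> norm (b * norm (\<xi> \<omega>))"
          using 1 by (simp add: \<eta>_def abs_mult mult.commute)
      qed
    qed
  qed
  have eq: "\<xi> \<omega> \<bullet> simple_integral B n \<tau> Z \<omega>
      = (\<Sum>i<n. \<Sum>j\<in>UNIV. \<Sum>k\<in>UNIV. \<eta> i j k \<omega> * (B (\<tau> (Suc i)) \<omega> - B (\<tau> i) \<omega>) $ j)" for \<omega>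
    unfolding simple_integral_def inner_sum_right dot_lmul_matrix[symmetric]
    by (simp add: inner_vec_def vector_matrix_mult_def \<eta>_def sum_distrib_right)
  have int: "integrable M (\<lambda>\<omega>. \<eta> i j k \<omega> * (B (\<tau> (Suc i)) \<omega> - B (\<tau> i) \<omega>) $ j)"
    and zero: "expectation (\<lambda>\<omega>. \<eta> i j k \<omega> * (B (\<tau> (Suc i)) \<omega> - B (\<tau> i) \<omega>) $ j) = 0"
    if "i \<in> {..<n}" for i j k
  proof -
    have i: "i < n" "i \<le> n" using that by auto
    show "integrable M (\<lambda>\<omega>. \<eta> i j k \<omega> * (B (\<tau> (Suc i)) \<omega> - B (\<tau> i) \<omega>) $ j)"
      "expectation (\<lambda>\<omega>. \<eta> i j k \<omega> * (B (\<tau> (Suc i)) \<omega> - B (\<tau> i) \<omega>) $ j) = 0"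
      using increment_orthogonal[OF ge0[OF i(2)] step(1)[OF i(1)] \<eta>m[OF i(1)] \<eta>i[OF i(1)]] by auto
  qed
  show "simple_integral B n \<tau> Z \<in> borel_measurable M"
    unfolding simple_integral_def[abs_def] matrix_vector_mult_def
  proof (intro borel_measurable_sum)
    fix i assume "i \<in> {..<n}"
    then have "i < n" by simp
    have [measurable]: "Z i \<in> borel_measurable M" "B (\<tau> (Suc i)) \<in> borel_measurable M" "B (\<tau> i) \<in> borel_measurable M"
      using filtered_spaceD(1)[OF filtered step(2)[OF \<open>i < n\<close>]] ge0[of i] ge0[of "Suc i"] \<open>i < n\<close> by auto
    have "(\<lambda>\<omega>. \<Sum>j\<in>UNIV. Z i \<omega> $ k $ j * (B (\<tau> (Suc i)) \<omega> - B (\<tau> i) \<omega>) $ j) \<in> borel_measurable M" for k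
      by measurable
    then show "(\<lambda>\<omega>. \<chi> k. \<Sum>j\<in>UNIV. Z i \<omega> $ k $ j * (B (\<tau> (Suc i)) \<omega> - B (\<tau> i) \<omega>) $ j) \<in> borel_measurable M"
      by (subst borel_measurable_euclidean_space) (auto simp: Basis_vec_def inner_axis)
  qed
  show "integrable M (\<lambda>\<omega>. \<xi> \<omega> \<bullet> simple_integral B n \<tau> Z \<omega>)"
    unfolding eq by (intro Bochner_Integration.integrable_sum int)
  show "expectation (\<lambda>\<omega>. \<xi> \<omega> \<bullet> simple_integral B n \<tau> Z \<omega>) = 0"
    unfolding eq
    by (simp add: Bochner_Integration.integral_sum Bochner_Integration.integrable_sum int zero
        del: vector_minus_component)
qed

text \<open>
  The simple integrals converge in \<open>L\<^sup>2\<close>, and the pairing with \<open>\<xi>\<close> is continuous there.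
\<close>

lemma ito_integral_orthogonal:
  assumes s: "0 \<le> s" and J: "has_ito_integral M Ft B Z s t J"
    and \<xi>: "\<xi> \<in> L2_rv M" "\<xi> \<in> borel_measurable (Ft s)"
  shows "integrable M (\<lambda>\<omega>. \<xi> \<omega> \<bullet> J \<omega>)" "expectation (\<lambda>\<omega>. \<xi> \<omega> \<bullet> J \<omega>) = 0"
proof -
  from J obtain n \<tau> Zs where J_meas: "J \<in> borel_measurable M"
    and si: "\<And>k. simple_integrand M Ft s t (n k) (\<tau> k) (Zs k)"
    and lim: "(\<lambda>k. \<integral>\<^sup>+ \<omega>. ennreal ((norm (J \<omega> - simple_integral B (n k) (\<tau> k) (Zs k) \<omega>))\<^sup>2) \<partial>M) \<longlonglongrightarrow> 0"
    unfolding has_ito_integral_def by blast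
  define S where "S k = simple_integral B (n k) (\<tau> k) (Zs k)" for k
  note S = simple_integral_orthogonal[OF s si \<xi>, folded S_def]
  have close: "\<exists>k. square_integrable M (\<lambda>\<omega>. J \<omega> - S k \<omega>) \<and> (\<integral>\<omega>. (norm (J \<omega> - S k \<omega>))\<^sup>2 \<partial>M) \<le> e" if "0 < e" for e
  proof -
    have "eventually (\<lambda>k. (\<integral>\<^sup>+ \<omega>. ennreal ((norm (J \<omega> - S k \<omega>))\<^sup>2) \<partial>M) < ennreal e) sequentially"
      using lim that unfolding S_def by (intro order_tendstoD(2)) auto
    then obtain k where k: "(\<integral>\<^sup>+ \<omega>. ennreal ((norm (J \<omega> - S k \<omega>))\<^sup>2) \<partial>M) < ennreal e"
      by (auto simp: eventually_sequentially)
    have m: "(\<lambda>\<omega>. J \<omega> - S k \<omega>) \<in> borel_measurable M" using J_meas S(1)[of k] by measurable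
    then have int: "integrable M (\<lambda>\<omega>. (norm (J \<omega> - S k \<omega>))\<^sup>2)"
      using order.strict_trans[OF k ennreal_less_top] by (intro integrableI_bounded) auto
    have "ennreal (\<integral>\<omega>. (norm (J \<omega> - S k \<omega>))\<^sup>2 \<partial>M) < ennreal e"
      using k nn_integral_eq_integral[OF int] by simp
    then have "(\<integral>\<omega>. (norm (J \<omega> - S k \<omega>))\<^sup>2 \<partial>M) \<le> e"
      by (simp add: ennreal_less_iff)
    with m int show ?thesis by (auto simp: square_integrable_def)
  qed
  have \<xi>': "square_integrable M \<xi>" using \<xi>(1) by (simp add: L2_rv_eq)
  define c where "c = (\<integral>\<omega>. (norm (\<xi> \<omega>))\<^sup>2 \<partial>M)"
  have c0: "0 \<le> c" by (simp add: c_def)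
  have est: "integrable M (\<lambda>\<omega>. \<xi> \<omega> \<bullet> J \<omega>) \<and> (expectation (\<lambda>\<omega>. \<xi> \<omega> \<bullet> J \<omega>))\<^sup>2 \<le> c * e" if e: "0 < e" for e
  proof -
    obtain k where k: "square_integrable M (\<lambda>\<omega>. J \<omega> - S k \<omega>)" "(\<integral>\<omega>. (norm (J \<omega> - S k \<omega>))\<^sup>2 \<partial>M) \<le> e"
      using close[OF e] by blast
    have split: "\<xi> \<omega> \<bullet> J \<omega> = \<xi> \<omega> \<bullet> (J \<omega> - S k \<omega>) + \<xi> \<omega> \<bullet> S k \<omega>" for \<omega>
      by (simp add: inner_diff_right)
    note i = integrable_inner[OF \<xi>' k(1)] S(2)[of k]
    have "(expectation (\<lambda>\<omega>. \<xi> \<omega> \<bullet> J \<omega>))\<^sup>2 = (\<integral>\<omega>. \<xi> \<omega> \<bullet> (J \<omega> - S k \<omega>) \<partial>M)\<^sup>2"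
      unfolding split using Bochner_Integration.integral_add[OF i] S(3)[of k] by simp
    also have "\<dots> \<le> c * (\<integral>\<omega>. (norm (J \<omega> - S k \<omega>))\<^sup>2 \<partial>M)"
      unfolding c_def by (rule Cauchy_Schwarz_integral[OF \<xi>' k(1)])
    also have "\<dots> \<le> c * e" using k(2) c0 by (rule mult_left_mono)
    finally have "(expectation (\<lambda>\<omega>. \<xi> \<omega> \<bullet> J \<omega>))\<^sup>2 \<le> c * e" .
    moreover have "integrable M (\<lambda>\<omega>. \<xi> \<omega> \<bullet> J \<omega>)"
      unfolding split by (intro Bochner_Integration.integrable_add i)
    ultimately show ?thesis by blast
  qed
  show "integrable M (\<lambda>\<omega>. \<xi> \<omega> \<bullet> J \<omega>)" using est[of 1] by simp
  have "(expectation (\<lambda>\<omega>. \<xi> \<omega> \<bullet> J \<omega>))\<^sup>2 \<le> 0"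
  proof (rule field_le_epsilon)
    fix e :: real assume e: "0 < e"
    have "(expectation (\<lambda>\<omega>. \<xi> \<omega> \<bullet> J \<omega>))\<^sup>2 \<le> c * (e / (1 + c))"
      using est[of "e / (1 + c)"] e c0 by simp
    also have "\<dots> \<le> e" using e c0 by (simp add: field_simps)
    finally show "(expectation (\<lambda>\<omega>. \<xi> \<omega> \<bullet> J \<omega>))\<^sup>2 \<le> 0 + e" by simp
  qed
  then show "expectation (\<lambda>\<omega>. \<xi> \<omega> \<bullet> J \<omega>) = 0" by simp
qed

end

section \<open>Coefficients along a solution\<close>

context time_horizon
begin

lemma lift_L2:
  fixes H :: "real^'d \<Rightarrow> (real^'d) measure \<Rightarrow> real^'d \<Rightarrow> real^'d"
  assumes cont: "\<And>\<mu>. \<mu> \<in> P2 \<Longrightarrow> continuous_on UNIV (\<lambda>(x, v). H x \<mu> v)"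
    and growth: "\<And>x \<mu> v. \<mu> \<in> P2 \<Longrightarrow> norm (H x \<mu> v) \<le> C * (1 + norm x + norm v + sqrt (E2 \<mu>))"
    and X: "X \<in> L2_rv M" and V: "V \<in> L2_rv M"
  shows "lift2 M H X V \<in> L2_rv M"
    and "X \<in> borel_measurable N \<Longrightarrow> V \<in> borel_measurable N \<Longrightarrow> lift2 M H X V \<in> borel_measurable N"
proof -
  have \<mu>: "law M X \<in> P2" by (rule law_in_P2[OF prob_space_axioms X])
  show meas: "lift2 M H X V \<in> borel_measurable N" if "X \<in> borel_measurable N" "V \<in> borel_measurable N" for N
  proof -
    have "(\<lambda>(x, v). H x (law M X) v) \<in> borel_measurable borel"
      by (rule borel_measurable_continuous_onI[OF cont[OF \<mu>]])
    then have "(\<lambda>(x, v). H x (law M X) v) \<in> borel_measurable (borel \<Otimes>\<^sub>M borel)"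
      by (simp add: borel_prod)
    from measurable_compose[OF measurable_Pair[OF that] this]
    show ?thesis by (simp add: lift2_def[abs_def])
  qed
  have "square_integrable M (lift2 M H X V)"
  proof (rule square_integrable_linear_growth)
    show "lift2 M H X V \<in> borel_measurable M" using meas X V by (simp add: L2_rv_def)
    show "square_integrable M X" "square_integrable M V" using X V by (simp_all add: L2_rv_eq)
    show "square_integrable M (\<lambda>_. L2_norm M X)" by (simp add: square_integrable_def)
    show "norm (lift2 M H X V z) \<le> C * (1 + norm (X z) + norm (V z) + L2_norm M X)" for z
      using growth[OF \<mu>, of "X z" "V z"] by (simp add: lift2_def E2_law[OF X])
  qed simp
  then show "lift2 M H X V \<in> L2_rv M" by (simp add: L2_rv_eq)
qed

lemma norm_process_square_integrable:
  assumes "process X"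
  shows "square_integrable (\<L> \<Otimes>\<^sub>M M) (\<lambda>(s, \<omega>). L2_norm M (X s))"
proof -
  have i: "integrable \<L> (\<lambda>s. (L2_norm M (X s))\<^sup>2)"
    unfolding L2_norm_sq by (rule process_inner_integrable[OF assms assms])
  have "(\<lambda>s. sqrt ((L2_norm M (X s))\<^sup>2)) \<in> borel_measurable \<L>" using i by measurable
  then have [measurable]: "(\<lambda>s. L2_norm M (X s)) \<in> borel_measurable \<L>" by simp
  show ?thesis using integrable_time_space_fst[OF i]
    by (simp add: square_integrable_def split_beta')
qed

lemma one_integrable_time_space: "integrable (\<L> \<Otimes>\<^sub>M M) (\<lambda>_. 1 :: real)"
  using integrable_time_space_fst[of "\<lambda>_. 1"] by (simp add: split_beta')

text \<open>
  The law enters through \<open>s\<close> only. If \<open>s \<mapsto> law (X s)\<close> is continuous for \<open>W2\<close>, the coefficient is a continuous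
  function of \<open>(s, x, v)\<close>, which makes the lift jointly measurable in time and chance; linear growth makes it
  square integrable.
\<close>

lemma lift_process:
  fixes H :: "real^'d \<Rightarrow> (real^'d) measure \<Rightarrow> real^'d \<Rightarrow> real^'d"
  assumes cont: "continuous_P2 (\<lambda>(x, v) \<mu>. H x \<mu> v)"
    and growth: "\<And>x \<mu> v. \<mu> \<in> P2 \<Longrightarrow> norm (H x \<mu> v) \<le> C * (1 + norm x + norm v + sqrt (E2 \<mu>))"
    and X: "process X" and V: "process V"
    and law_cont: "\<And>s e. s \<in> {0..T} \<Longrightarrow> 0 < e \<Longrightarrow>
      \<exists>d>0. \<forall>s'\<in>{0..T}. \<bar>s' - s\<bar> < d \<longrightarrow> W2 (law M (X s')) (law M (X s)) < e"
  shows "process (\<lambda>s. lift2 M H (X s) (V s))"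
proof -
  note law = law_in_P2[OF prob_space_axioms processD(2)[OF X]]
  have L2: "lift2 M H (X s) (V s) \<in> L2_rv M" if "s \<in> {0..T}" for s
    by (rule lift_L2(1)[OF _ growth processD(2)[OF X that] processD(2)[OF V that]])
       (use continuous_P2_fixed_law[OF cont] in \<open>auto simp: split_beta'\<close>)
  let ?\<Phi> = "\<lambda>(s, z). case z of (x, v) \<Rightarrow> H x (law M (X s)) v"
  have "continuous_on ({0..T} \<times> UNIV) ?\<Phi>"
    unfolding continuous_on_iff
  proof (intro ballI allI impI)
    fix p and e :: real assume p: "p \<in> {0..T} \<times> (UNIV :: ((real^'d) \<times> (real^'d)) set)" and e: "0 < e"
    obtain s x v where [simp]: "p = (s, x, v)" by (cases p) auto
    have s: "s \<in> {0..T}" using p by simp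
    have "\<exists>d>0. \<forall>z'. \<forall>\<mu>'\<in>P2. dist z' (x, v) < d \<and> W2 \<mu>' (law M (X s)) < d \<longrightarrow>
        dist ((\<lambda>(x, v) \<mu>. H x \<mu> v) z' \<mu>') ((\<lambda>(x, v) \<mu>. H x \<mu> v) (x, v) (law M (X s))) < e"
      using cont[unfolded continuous_P2_def, THEN spec, THEN bspec, OF law[OF s]] e by blast
    then obtain d where d: "0 < d" "\<And>x' v' \<mu>'. \<mu>' \<in> P2 \<Longrightarrow> dist (x', v') (x, v) < d \<Longrightarrow>
        W2 \<mu>' (law M (X s)) < d \<Longrightarrow> dist (H x' \<mu>' v') (H x (law M (X s)) v) < e"
      by auto
    obtain d' where d': "0 < d'" "\<And>s'. s' \<in> {0..T} \<Longrightarrow> \<bar>s' - s\<bar> < d' \<Longrightarrow> W2 (law M (X s')) (law M (X s)) < d"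
      using law_cont[OF s d(1)] by blast
    show "\<exists>\<delta>>0. \<forall>y\<in>{0..T} \<times> UNIV. dist y p < \<delta> \<longrightarrow> dist (?\<Phi> y) (?\<Phi> p) < e"
    proof (intro exI[of _ "min d d'"] conjI ballI impI)
      show "0 < min d d'" using d d' by simp
      fix y assume y: "y \<in> {0..T} \<times> UNIV" "dist y p < min d d'"
      obtain s' x' v' where [simp]: "y = (s', x', v')" by (cases y) auto
      have "dist s' s < min d d'" "dist (x', v') (x, v) < min d d'"
        using y(2) dist_fst_le[of y p] dist_snd_le[of y p] by simp_all
      then show "dist (?\<Phi> y) (?\<Phi> p) < e"
        using d(2)[OF law _ d'(2)] y(1) by (simp add: dist_real_def)
    qed
  qed
  from borel_measurable_continuous_on_restrict[OF this]
  have \<Phi>: "?\<Phi> \<in> borel_measurable (restrict_space borel ({0..T} \<times> UNIV))" .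
  have "(\<lambda>z. (fst z, X (fst z) (snd z), V (fst z) (snd z)))
      \<in> measurable (\<L> \<Otimes>\<^sub>M M) (restrict_space borel ({0..T} \<times> UNIV))"
  proof (rule measurable_restrict_space2)
    have id: "(\<lambda>x. x) \<in> borel_measurable \<L>" by (simp add: measurable_restrict_space1)
    have [measurable]: "(\<lambda>z. X (fst z) (snd z)) \<in> borel_measurable (\<L> \<Otimes>\<^sub>M M)"
      "(\<lambda>z. V (fst z) (snd z)) \<in> borel_measurable (\<L> \<Otimes>\<^sub>M M)"
      using process_measurable[OF X] process_measurable[OF V] by (simp_all add: split_beta')
    have "fst \<in> borel_measurable (\<L> \<Otimes>\<^sub>M M)"
      by (rule measurable_compose[OF measurable_fst id])
    then show "(\<lambda>z. (fst z, X (fst z) (snd z), V (fst z) (snd z))) \<in> borel_measurable (\<L> \<Otimes>\<^sub>M M)"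
      by measurable
  qed (auto simp: space_pair_measure)
  from measurable_compose[OF this \<Phi>]
  have meas: "(\<lambda>(s, \<omega>). lift2 M H (X s) (V s) \<omega>) \<in> borel_measurable (\<L> \<Otimes>\<^sub>M M)"
    by (simp add: lift2_def split_beta')
  have "square_integrable (\<L> \<Otimes>\<^sub>M M) (\<lambda>(s, \<omega>). lift2 M H (X s) (V s) \<omega>)"
  proof (rule square_integrable_linear_growth[OF meas one_integrable_time_space
        processD(1)[OF X] processD(1)[OF V] norm_process_square_integrable[OF X]])
    fix z assume "z \<in> space (\<L> \<Otimes>\<^sub>M M)"
    then obtain s \<omega> where z: "z = (s, \<omega>)" "s \<in> {0..T}" by (auto simp: space_pair_measure)
    then show "norm (case z of (s, \<omega>) \<Rightarrow> lift2 M H (X s) (V s) \<omega>)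
        \<le> C * (1 + norm (case z of (t, \<omega>) \<Rightarrow> X t \<omega>) + norm (case z of (t, \<omega>) \<Rightarrow> V t \<omega>)
          + (case z of (s, \<omega>) \<Rightarrow> L2_norm M (X s)))"
      using growth[OF law[OF z(2)], of "X s \<omega>" "V s \<omega>"] E2_law[OF processD(2)[OF X z(2)]]
      by (simp add: lift2_def)
  qed
  with L2 show ?thesis by (simp add: process_def)
qed

end

section \<open>Strong solutions\<close>

text \<open>
  Growth and continuity of the coefficients turn a pair of strong solutions into an instance of
  \<open>coupled_system\<close>; monotonicity enters after that, in \<open>stability\<close>.
\<close>

locale driven_system = time_horizon M T + brownian M Ft B
  for M :: "'a measure" and T :: real and Ft and B :: "real \<Rightarrow> 'a \<Rightarrow> real^'d" +
  fixes W0 :: "real^'d \<Rightarrow> (real^'d) measure \<Rightarrow> real^'d"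
    and F G :: "real^'d \<Rightarrow> (real^'d) measure \<Rightarrow> real^'d \<Rightarrow> real^'d"
    and C \<sigma> :: real
  assumes W0_cont: "continuous_P2 W0"
    and F_cont: "continuous_P2 (\<lambda>(x, v) \<mu>. F x \<mu> v)"
    and G_cont: "continuous_P2 (\<lambda>(x, v) \<mu>. G x \<mu> v)"
    and W0_growth: "\<And>x \<mu>. \<mu> \<in> P2 \<Longrightarrow> norm (W0 x \<mu>) \<le> C * (1 + norm x + sqrt (E2 \<mu>))"
    and F_growth: "\<And>x \<mu> v. \<mu> \<in> P2 \<Longrightarrow> norm (F x \<mu> v) \<le> C * (1 + norm x + norm v + sqrt (E2 \<mu>))"
    and G_growth: "\<And>x \<mu> v. \<mu> \<in> P2 \<Longrightarrow> norm (G x \<mu> v) \<le> C * (1 + norm x + norm v + sqrt (E2 \<mu>))"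
begin

lemma lift1_L2:
  assumes X: "X \<in> L2_rv M"
  shows "lift1 M W0 X \<in> L2_rv M"
proof -
  have "lift2 M (\<lambda>x \<mu> v. W0 x \<mu>) X (\<lambda>_. 0) \<in> L2_rv M"
  proof (rule lift_L2(1))
    fix \<mu> :: "(real^'d) measure" assume \<mu>: "\<mu> \<in> P2"
    have "continuous_on UNIV (\<lambda>z :: (real^'d) \<times> (real^'d). W0 (fst z) \<mu>)"
      by (rule continuous_on_compose2[OF continuous_P2_fixed_law[OF W0_cont \<mu>]])
         (auto intro: continuous_intros)
    then show "continuous_on UNIV (\<lambda>(x, v :: real^'d). W0 x \<mu>)" by (simp add: split_beta')
    fix x v :: "real^'d"
    have "0 < 1 + sqrt (E2 \<mu>)" by (simp add: E2_def add_pos_nonneg)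
    moreover have "0 \<le> C * (1 + sqrt (E2 \<mu>))"
      using order_trans[OF norm_ge_zero W0_growth[OF \<mu>, of 0]] by simp
    ultimately have "0 \<le> C" by (simp only: zero_le_mult_iff) linarith
    then have "C * (1 + norm x + sqrt (E2 \<mu>)) \<le> C * (1 + norm x + norm v + sqrt (E2 \<mu>))"
      by (intro mult_left_mono) auto
    then show "norm (W0 x \<mu>) \<le> C * (1 + norm x + norm v + sqrt (E2 \<mu>))"
      using W0_growth[OF \<mu>, of x] by linarith
  qed (use X in \<open>auto simp: L2_rv_def\<close>)
  then show ?thesis by (simp add: lift1_def lift2_def)
qed

lemma adapted_process:
  fixes V :: "real \<Rightarrow> 'a \<Rightarrow> real^'d"
  assumes "adapted_L2_process M Ft T V" "\<forall>t\<in>{0..T}. V t \<in> L2_rv M"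
  shows "process V"
  using assms by (simp add: process_def square_integrable_def adapted_L2_process_def time_space_def split_beta')

definition solution where
  "solution X0 X W Z \<longleftrightarrow> strong_solution M Ft B T \<sigma> W0 F G X0 X W Z"

lemma solution_processes:
  assumes "solution X0 X W Z"
  shows "process X" "process W"
    and "t \<in> {0..T} \<Longrightarrow> X t \<in> borel_measurable (Ft t)" "t \<in> {0..T} \<Longrightarrow> W t \<in> borel_measurable (Ft t)"
  using assms adapted_process unfolding solution_def strong_solution_def
  by (auto simp: adapted_L2_process_def)

lemma solution_forward:
  assumes "solution X0 X W Z" and t: "t \<in> {0..T}"
  shows "AE \<omega> in M. set_integrable \<L> {0..t} (\<lambda>s. lift2 M F (X s) (W s) \<omega>) \<and>
    X t \<omega> = X0 \<omega> - (LINT s:{0..t}|\<L>. lift2 M F (X s) (W s) \<omega>) + \<sigma> *\<^sub>R B t \<omega>"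
proof -
  have "AE \<omega> in M. set_integrable lborel {0..t} (\<lambda>s. lift2 M F (X s) (W s) \<omega>) \<and>
        X t \<omega> = X0 \<omega> - (LINT s:{0..t}|lborel. lift2 M F (X s) (W s) \<omega>) + \<sigma> *\<^sub>R B t \<omega>"
    using assms unfolding solution_def strong_solution_def by blast
  then show ?thesis using t by (simp add: set_integral_time)
qed

text \<open>
  The drift is bounded along each path by the linear growth majorant \<open>H\<close>, which unlike the drift is known to
  be jointly measurable, since the law enters it through the norm of \<open>X s\<close>. Cauchy-Schwarz in time then
  gives an increment of order \<open>t - s\<close> for the squared norm, and so does the Brownian part.
\<close>

lemma solution_increment:
  assumes sol: "solution X0 X W Z"
  shows "\<exists>K\<ge>0. \<forall>s t. 0 \<le> s \<longrightarrow> s \<le> t \<longrightarrow> t \<le> T \<longrightarrow> (L2_norm M (X t - X s))\<^sup>2 \<le> K * (t - s)"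
proof -
  note X = solution_processes(1)[OF sol] and W = solution_processes(2)[OF sol]
  define H where "H s \<omega> = \<bar>C\<bar> * (1 + norm (X s \<omega>) + norm (W s \<omega>) + L2_norm M (X s))" for s \<omega>
  have bound: "norm (lift2 M F (X s) (W s) \<omega>) \<le> H s \<omega>" if "s \<in> {0..T}" for s \<omega>
  proof -
    have "norm (lift2 M F (X s) (W s) \<omega>) \<le> C * (1 + norm (X s \<omega>) + norm (W s \<omega>) + L2_norm M (X s))"
      using F_growth[OF law_in_P2[OF prob_space_axioms processD(2)[OF X that]], of "X s \<omega>" "W s \<omega>"]
        E2_law[OF processD(2)[OF X that]] by (simp add: lift2_def)
    also have "\<dots> \<le> H s \<omega>" unfolding H_def by (intro mult_right_mono) auto
    finally show ?thesis .
  qed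
  have H: "square_integrable (\<L> \<Otimes>\<^sub>M M) (\<lambda>(s, \<omega>). H s \<omega>)"
  proof (rule square_integrable_linear_growth[OF _ one_integrable_time_space
        processD(1)[OF X] processD(1)[OF W] norm_process_square_integrable[OF X]])
    have [measurable]: "(\<lambda>z. X (fst z) (snd z)) \<in> borel_measurable (\<L> \<Otimes>\<^sub>M M)"
      "(\<lambda>z. W (fst z) (snd z)) \<in> borel_measurable (\<L> \<Otimes>\<^sub>M M)"
      "(\<lambda>z. L2_norm M (X (fst z))) \<in> borel_measurable (\<L> \<Otimes>\<^sub>M M)"
      using process_measurable[OF X] process_measurable[OF W]
        square_integrableD(1)[OF norm_process_square_integrable[OF X]] by (simp_all add: split_beta')
    show "(\<lambda>(s, \<omega>). H s \<omega>) \<in> borel_measurable (\<L> \<Otimes>\<^sub>M M)"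
      unfolding H_def split_beta' by measurable
    fix z assume "z \<in> space (\<L> \<Otimes>\<^sub>M M)"
    show "norm (case z of (s, \<omega>) \<Rightarrow> H s \<omega>) \<le> \<bar>C\<bar> * (1 + norm (case z of (t, \<omega>) \<Rightarrow> X t \<omega>)
        + norm (case z of (t, \<omega>) \<Rightarrow> W t \<omega>) + (case z of (s, \<omega>) \<Rightarrow> L2_norm M (X s)))"
      by (auto simp: H_def split_beta' abs_mult)
  qed
  have paths: "AE \<omega> in M. square_integrable \<L> (\<lambda>s. H s \<omega>)"
    by (rule process_path_square_integrable[OF H])
  have iH: "integrable M (\<lambda>\<omega>. \<integral>s. (norm (H s \<omega>))\<^sup>2 \<partial>\<L>)"
    using time_space.integrable_snd[of "\<lambda>s \<omega>. (norm (H s \<omega>))\<^sup>2"] square_integrableD(2)[OF H]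
    by (simp add: split_beta')
  define K where "K = 2 * (\<integral>\<omega>. (\<integral>s. (norm (H s \<omega>))\<^sup>2 \<partial>\<L>) \<partial>M) + 2 * \<sigma>\<^sup>2 * real CARD('d)"
  have K0: "0 \<le> K" by (auto simp: K_def intro!: add_nonneg_nonneg Bochner_Integration.integral_nonneg)
  have "(L2_norm M (X t - X s))\<^sup>2 \<le> K * (t - s)" if st: "0 \<le> s" "s \<le> t" "t \<le> T" for s t
  proof -
    have in_time: "s \<in> {0..T}" "t \<in> {0..T}" using st by auto
    let ?bound = "\<lambda>\<omega>. 2 * ((t - s) * (\<integral>r. (norm (H r \<omega>))\<^sup>2 \<partial>\<L>) + \<sigma>\<^sup>2 * (norm (B t \<omega> - B s \<omega>))\<^sup>2)"
    note B2 = increment_second_moment[OF st(1,2)]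
    have "AE \<omega> in M. (norm ((X t - X s) \<omega>))\<^sup>2 \<le> ?bound \<omega>"
      using paths solution_forward[OF sol in_time(1)] solution_forward[OF sol in_time(2)]
    proof eventually_elim
      case (elim \<omega>)
      let ?f = "\<lambda>r. lift2 M F (X r) (W r) \<omega>"
      have fi: "set_integrable \<L> {0..t} ?f" using elim by blast
      have fi': "set_integrable \<L> {s..t} ?f"
        by (rule set_integrable_subset[OF fi]) (use st Icc_sets_time in auto)
      have Hi: "set_integrable \<L> {s..t} (\<lambda>r. H r \<omega>)"
        using st time.integrable_square_integrable[OF elim(1)] by (intro set_integrable_time) auto
      have eq: "(X t - X s) \<omega> = - (LINT r:{s..t}|\<L>. ?f r) + \<sigma> *\<^sub>R (B t \<omega> - B s \<omega>)"
      proof -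
        have "X t \<omega> = X0 \<omega> - ((LINT r:{0..s}|\<L>. ?f r) + (LINT r:{s..t}|\<L>. ?f r)) + \<sigma> *\<^sub>R B t \<omega>"
          using elim(3) set_integral_time_split[OF fi _ st(1,2,3)] by simp
        moreover have "X s \<omega> = X0 \<omega> - (LINT r:{0..s}|\<L>. ?f r) + \<sigma> *\<^sub>R B s \<omega>"
          using elim(2) by blast
        ultimately show ?thesis by (simp add: scaleR_diff_right)
      qed
      have "norm (LINT r:{s..t}|\<L>. ?f r) \<le> (LINT r:{s..t}|\<L>. norm (?f r))"
        by (rule set_integral_norm_bound[OF fi'])
      also have "\<dots> \<le> (LINT r:{s..t}|\<L>. H r \<omega>)"
        by (rule set_integral_mono[OF set_integrable_norm[OF fi'] Hi]) (use st bound in auto)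
      finally have "(norm (LINT r:{s..t}|\<L>. ?f r))\<^sup>2 \<le> (norm (LINT r:{s..t}|\<L>. H r \<omega>))\<^sup>2"
        by (intro power_mono) auto
      also have "\<dots> \<le> measure \<L> {s..t} * (\<integral>r. (norm (H r \<omega>))\<^sup>2 \<partial>\<L>)"
        by (rule norm_set_integral_sq_le[OF elim(1)])
           (use st Icc_sets_time in \<open>auto simp: time.emeasure_eq_measure\<close>)
      finally have 1: "(norm (LINT r:{s..t}|\<L>. ?f r))\<^sup>2 \<le> (t - s) * (\<integral>r. (norm (H r \<omega>))\<^sup>2 \<partial>\<L>)"
        using st by (simp add: measure_time_Icc)
      have "(norm ((X t - X s) \<omega>))\<^sup>2 \<le> 2 * ((norm (- (LINT r:{s..t}|\<L>. ?f r)))\<^sup>2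
          + (norm (\<sigma> *\<^sub>R (B t \<omega> - B s \<omega>)))\<^sup>2)"
        unfolding eq by (rule norm_add_sq_le)
      also have "\<dots> = 2 * ((norm (LINT r:{s..t}|\<L>. ?f r))\<^sup>2 + \<sigma>\<^sup>2 * (norm (B t \<omega> - B s \<omega>))\<^sup>2)"
        by (simp add: power_mult_distrib)
      also have "\<dots> \<le> ?bound \<omega>" using 1 by simp
      finally show ?case .
    qed
    moreover have "X t - X s \<in> L2_rv M" using L2_rv_diff processD(2)[OF X] in_time by blast
    moreover have "integrable M ?bound"
      using iH B2(1) by (intro integrable_mult_right Bochner_Integration.integrable_add)
    ultimately have "(\<integral>\<omega>. (norm ((X t - X s) \<omega>))\<^sup>2 \<partial>M) \<le> (\<integral>\<omega>. ?bound \<omega> \<partial>M)"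
      by (intro integral_mono_AE) (auto simp: L2_rv_def)
    also have "\<dots> = 2 * ((t - s) * (\<integral>\<omega>. (\<integral>r. (norm (H r \<omega>))\<^sup>2 \<partial>\<L>) \<partial>M)
        + \<sigma>\<^sup>2 * (\<integral>\<omega>. (norm (B t \<omega> - B s \<omega>))\<^sup>2 \<partial>M))"
      using iH B2(1) by simp
    also have "\<dots> = K * (t - s)"
      unfolding B2(2) by (simp add: K_def algebra_simps)
    finally show ?thesis by (simp add: L2_norm_sq_integral)
  qed
  with K0 show ?thesis by blast
qed

lemma solution_law_continuous:
  assumes sol: "solution X0 X W Z" and s: "s \<in> {0..T}" and e: "0 < e"
  shows "\<exists>d>0. \<forall>s'\<in>{0..T}. \<bar>s' - s\<bar> < d \<longrightarrow> W2 (law M (X s')) (law M (X s)) < e"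
proof -
  note X = solution_processes(1)[OF sol]
  obtain K where K: "0 \<le> K" and inc: "\<And>s t. 0 \<le> s \<Longrightarrow> s \<le> t \<Longrightarrow> t \<le> T \<Longrightarrow> (L2_norm M (X t - X s))\<^sup>2 \<le> K * (t - s)"
    using solution_increment[OF sol] by blast
  have "W2 (law M (X s')) (law M (X s)) < e" if s': "s' \<in> {0..T}" "\<bar>s' - s\<bar> < e\<^sup>2 / (K + 1)" for s'
  proof -
    have "L2_norm M (X s' - X s) = L2_norm M (X s - X s')"
      by (simp add: L2_norm_def L2_inner_def power2_norm_eq_inner[symmetric] norm_minus_commute)
    then have "(L2_norm M (X s' - X s))\<^sup>2 \<le> K * \<bar>s' - s\<bar>"
      using inc[of s s'] inc[of s' s] s s' by (cases "s \<le> s'") auto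
    also have "\<dots> \<le> (K + 1) * \<bar>s' - s\<bar>" by (intro mult_right_mono) auto
    also have "\<dots> < e\<^sup>2" using s'(2) K by (simp add: pos_less_divide_eq mult.commute)
    finally have "L2_norm M (X s' - X s) < e" using e by (auto dest: power_less_imp_less_base)
    then show ?thesis
      using W2_law_le[OF prob_space_axioms processD(2)[OF X s'(1)] processD(2)[OF X s]] by linarith
  qed
  moreover have "0 < e\<^sup>2 / (K + 1)" using e K by simp
  ultimately show ?thesis by blast
qed

lemma solution_coefficients:
  assumes sol: "solution X0 X W Z"
  shows "process (\<lambda>s. lift2 M F (X s) (W s))" "process (\<lambda>s. lift2 M G (X s) (W s))"
    and "t \<in> {0..T} \<Longrightarrow> lift2 M F (X t) (W t) \<in> borel_measurable (Ft t)"
    and "t \<in> {0..T} \<Longrightarrow> lift2 M G (X t) (W t) \<in> borel_measurable (Ft t)"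
proof -
  note X = solution_processes[OF sol]
  note lc = solution_law_continuous[OF sol]
  show "process (\<lambda>s. lift2 M F (X s) (W s))"
    by (rule lift_process[OF F_cont F_growth X(1,2) lc])
  show "process (\<lambda>s. lift2 M G (X s) (W s))"
    by (rule lift_process[OF G_cont G_growth X(1,2) lc])
  have c: "continuous_on UNIV (\<lambda>(x, v). F x \<mu> v)" "continuous_on UNIV (\<lambda>(x, v). G x \<mu> v)"
    if "\<mu> \<in> P2" for \<mu>
    using continuous_P2_fixed_law[OF F_cont that] continuous_P2_fixed_law[OF G_cont that]
    by (simp_all add: split_beta')
  assume t: "t \<in> {0..T}"
  show "lift2 M F (X t) (W t) \<in> borel_measurable (Ft t)"
    by (rule lift_L2(2)[OF c(1) F_growth processD(2)[OF X(1) t] processD(2)[OF X(2) t] X(3)[OF t] X(4)[OF t]])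
  show "lift2 M G (X t) (W t) \<in> borel_measurable (Ft t)"
    by (rule lift_L2(2)[OF c(2) G_growth processD(2)[OF X(1) t] processD(2)[OF X(2) t] X(3)[OF t] X(4)[OF t]])
qed

text \<open>
  The stochastic integral over \<open>[t,T]\<close> disappears when tested with a variable known at time \<open>t\<close>.
\<close>

lemma solution_backward:
  assumes sol: "solution X0 X W Z" and t: "t \<in> {0..T}"
    and \<xi>: "\<xi> \<in> L2_rv M" "\<xi> \<in> borel_measurable (Ft t)"
  shows "L2_inner M \<xi> (W t) = L2_inner M \<xi> (lift1 M W0 (X T))
    + (LINT s:{t..T}|\<L>. L2_inner M \<xi> (lift2 M G (X s) (W s)))"
proof -
  note X = solution_processes[OF sol] and g = solution_coefficients(2)[OF sol]
  have h: "lift1 M W0 (X T) \<in> L2_rv M" using processD(2)[OF X(1), of T] T_pos by (intro lift1_L2) auto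
  have tT: "{t..T} \<in> sets \<L>" using t by (intro Icc_sets_time) auto
  define R where "R = (\<lambda>\<omega>. LINT s:{t..T}|\<L>. lift2 M G (X s) (W s) \<omega>)"
  have R: "R \<in> L2_rv M" unfolding R_def by (rule time_integral_L2[OF g tT])
  obtain J where J: "has_ito_integral M Ft B Z t T J" and
    "AE \<omega> in M. set_integrable lborel {t..T} (\<lambda>s. lift2 M G (X s) (W s) \<omega>) \<and>
      W t \<omega> = lift1 M W0 (X T) \<omega> + (LINT s:{t..T}|lborel. lift2 M G (X s) (W s) \<omega>) - J \<omega>"
    using sol t unfolding solution_def strong_solution_def by blast
  then have eq: "AE \<omega> in M. W t \<omega> = lift1 M W0 (X T) \<omega> + R \<omega> - J \<omega>"
    using t by (simp add: set_integral_time R_def)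
  note orth = ito_integral_orthogonal[OF _ J \<xi>]
  have S: "(\<lambda>\<omega>. lift1 M W0 (X T) \<omega> + R \<omega>) \<in> L2_rv M" by (rule L2_rv_add[OF h R])
  have iS: "integrable M (\<lambda>\<omega>. \<xi> \<omega> \<bullet> (lift1 M W0 (X T) \<omega> + R \<omega>))"
    using \<xi>(1) S by (simp add: integrable_inner L2_rv_eq)
  have "L2_inner M \<xi> (W t) = (\<integral>\<omega>. \<xi> \<omega> \<bullet> (lift1 M W0 (X T) \<omega> + R \<omega>) - \<xi> \<omega> \<bullet> J \<omega> \<partial>M)"
    unfolding L2_inner_def
  proof (rule integral_cong_AE)
    have [measurable]: "\<xi> \<in> borel_measurable M" "W t \<in> borel_measurable M"
      using \<xi>(1) processD(2)[OF X(2) t] by (simp_all add: L2_rv_def)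
    show "(\<lambda>\<omega>. \<xi> \<omega> \<bullet> W t \<omega>) \<in> borel_measurable M" by measurable
    show "(\<lambda>\<omega>. \<xi> \<omega> \<bullet> (lift1 M W0 (X T) \<omega> + R \<omega>) - \<xi> \<omega> \<bullet> J \<omega>) \<in> borel_measurable M"
      using iS orth(1) t by (intro borel_measurable_diff borel_measurable_integrable) auto
    show "AE \<omega> in M. \<xi> \<omega> \<bullet> W t \<omega> = \<xi> \<omega> \<bullet> (lift1 M W0 (X T) \<omega> + R \<omega>) - \<xi> \<omega> \<bullet> J \<omega>"
      using eq by eventually_elim (simp add: inner_diff_right)
  qed
  also have "\<dots> = L2_inner M \<xi> (\<lambda>\<omega>. lift1 M W0 (X T) \<omega> + R \<omega>)"
    using iS orth t by (simp add: L2_inner_def)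
  also have "\<dots> = L2_inner M \<xi> (lift1 M W0 (X T)) + L2_inner M \<xi> R"
    by (rule L2_inner_add_right[OF \<xi>(1) h R])
  also have "L2_inner M \<xi> R = (LINT s:{t..T}|\<L>. L2_inner M \<xi> (lift2 M G (X s) (W s)))"
    unfolding R_def by (rule inner_time_integral[OF g \<xi>(1) tT])
  finally show ?thesis .
qed

text \<open>
  Both forward equations contain the same \<open>\<sigma> B\<close>, which cancels in the difference. In the backward equation
  the test variables \<open>f t\<close>, \<open>g t\<close>, \<open>u t\<close>, and \<open>x0\<close> at time \<open>0\<close>, are known at time \<open>t\<close>.
\<close>

lemma difference_coupled_system:
  assumes sx: "solution X0 X Wx Zx" and sy: "solution Y0 Y Wy Zy"
    and X0: "X0 \<in> L2_rv M" "X0 \<in> borel_measurable (Ft 0)"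
    and Y0: "Y0 \<in> L2_rv M" "Y0 \<in> borel_measurable (Ft 0)"
  shows "coupled_system M T (\<lambda>t. X t - Y t) (\<lambda>t. Wx t - Wy t)
    (\<lambda>t. lift2 M F (X t) (Wx t) - lift2 M F (Y t) (Wy t))
    (\<lambda>t. lift2 M G (X t) (Wx t) - lift2 M G (Y t) (Wy t))
    (X0 - Y0) (lift1 M W0 (X T) - lift1 M W0 (Y T))"
proof -
  note px = solution_processes[OF sx] and py = solution_processes[OF sy]
  note cx = solution_coefficients[OF sx] and cy = solution_coefficients[OF sy]
  have T: "T \<in> {0..T}" using T_pos by auto
  have hx: "lift1 M W0 (X T) \<in> L2_rv M" and hy: "lift1 M W0 (Y T) \<in> L2_rv M"
    using lift1_L2 processD(2)[OF px(1) T] processD(2)[OF py(1) T] by auto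
  note x = process_diff[OF px(1) py(1)] and u = process_diff[OF px(2) py(2)]
  note f = process_diff[OF cx(1) cy(1)] and g = process_diff[OF cx(2) cy(2)]
  note x0 = L2_rv_diff[OF X0(1) Y0(1)] and h = L2_rv_diff[OF hx hy]
  show ?thesis
  proof (unfold_locales; (rule x u f g x0 h)?)
    fix t and \<xi> :: "'a \<Rightarrow> real^'d" assume t: "t \<in> {0..T}" and \<xi>: "\<xi> \<in> L2_rv M"
    let ?f = "\<lambda>s. lift2 M F (X s) (Wx s) - lift2 M F (Y s) (Wy s)"
    have tT: "{0..t} \<in> sets \<L>" using t by (intro Icc_sets_time) auto
    have P: "(\<lambda>\<omega>. LINT s:{0..t}|\<L>. ?f s \<omega>) \<in> L2_rv M" by (rule time_integral_L2[OF f tT])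
    have "AE \<omega> in M. (X t - Y t) \<omega> = ((X0 - Y0) - (\<lambda>\<omega>. LINT s:{0..t}|\<L>. ?f s \<omega>)) \<omega>"
      using solution_forward[OF sx t] solution_forward[OF sy t]
      by eventually_elim (simp add: set_integral_diff)
    then have "L2_inner M \<xi> (X t - Y t) = L2_inner M \<xi> ((X0 - Y0) - (\<lambda>\<omega>. LINT s:{0..t}|\<L>. ?f s \<omega>))"
      by (rule L2_inner_cong_AE[OF _ \<xi> processD(2)[OF x t] L2_rv_diff[OF x0 P]])
    also have "\<dots> = L2_inner M \<xi> (X0 - Y0) - L2_inner M \<xi> (\<lambda>\<omega>. LINT s:{0..t}|\<L>. ?f s \<omega>)"
      by (rule L2_inner_diff_right[OF \<xi> x0 P])
    finally show "L2_inner M \<xi> (X t - Y t)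
        = L2_inner M \<xi> (X0 - Y0) - (LINT s:{0..t}|\<L>. L2_inner M \<xi> (?f s))"
      by (simp only: inner_time_integral[OF f \<xi> tT])
  next
    fix t and \<xi> :: "'a \<Rightarrow> real^'d" assume t: "t \<in> {0..T}"
    let ?f = "\<lambda>s. lift2 M F (X s) (Wx s) - lift2 M F (Y s) (Wy s)"
    let ?g = "\<lambda>s. lift2 M G (X s) (Wx s) - lift2 M G (Y s) (Wy s)"
    assume "\<xi> \<in> {?f t, ?g t, Wx t - Wy t} \<or> t = 0 \<and> \<xi> = X0 - Y0"
    then have \<xi>: "\<xi> \<in> L2_rv M" "\<xi> \<in> borel_measurable (Ft t)"
      using processD(2)[OF f t] processD(2)[OF g t] processD(2)[OF u t] x0
        cx(3,4)[OF t] cy(3,4)[OF t] px(4)[OF t] py(4)[OF t] X0(2) Y0(2)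
      by (auto simp: fun_diff_def)
    have int: "set_integrable \<L> {t..T} (\<lambda>s. L2_inner M \<xi> (lift2 M G (X s) (Wx s)))"
      "set_integrable \<L> {t..T} (\<lambda>s. L2_inner M \<xi> (lift2 M G (Y s) (Wy s)))"
      using t by (intro set_integrable_time process_inner_integrable process_const[OF \<xi>(1)] cx(2) cy(2); simp)+
    have "L2_inner M \<xi> (Wx t - Wy t) = L2_inner M \<xi> (Wx t) - L2_inner M \<xi> (Wy t)"
      by (rule L2_inner_diff_right[OF \<xi>(1) processD(2)[OF px(2) t] processD(2)[OF py(2) t]])
    also have "\<dots> = (L2_inner M \<xi> (lift1 M W0 (X T)) - L2_inner M \<xi> (lift1 M W0 (Y T)))
       + ((LINT s:{t..T}|\<L>. L2_inner M \<xi> (lift2 M G (X s) (Wx s)))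
         - (LINT s:{t..T}|\<L>. L2_inner M \<xi> (lift2 M G (Y s) (Wy s))))"
      using solution_backward[OF sx t \<xi>] solution_backward[OF sy t \<xi>] by simp
    also have "L2_inner M \<xi> (lift1 M W0 (X T)) - L2_inner M \<xi> (lift1 M W0 (Y T))
        = L2_inner M \<xi> (lift1 M W0 (X T) - lift1 M W0 (Y T))"
      by (rule L2_inner_diff_right[OF \<xi>(1) hx hy, symmetric])
    also have "(LINT s:{t..T}|\<L>. L2_inner M \<xi> (lift2 M G (X s) (Wx s)))
         - (LINT s:{t..T}|\<L>. L2_inner M \<xi> (lift2 M G (Y s) (Wy s)))
        = (LINT s:{t..T}|\<L>. L2_inner M \<xi> (?g s))"
      unfolding set_integral_diff(2)[OF int, symmetric]
      using t by (intro set_lebesgue_integral_cong Icc_sets_time)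
        (auto simp: L2_inner_diff_right[OF \<xi>(1) processD(2)[OF cx(2)] processD(2)[OF cy(2)]])
    finally show "L2_inner M \<xi> (Wx t - Wy t) = L2_inner M \<xi> (lift1 M W0 (X T) - lift1 M W0 (Y T))
        + (LINT s:{t..T}|\<L>. L2_inner M \<xi> (?g s))" .
  qed
qed

end

section \<open>The stability estimate\<close>

theorem lemma3p27:
  fixes M :: "'a measure"
    and W0 :: "real^'d \<Rightarrow> (real^'d) measure \<Rightarrow> real^'d"
    and F G :: "real^'d \<Rightarrow> (real^'d) measure \<Rightarrow> real^'d \<Rightarrow> real^'d"
    and T C1 C2 \<alpha> a0 \<gamma> :: real
    and w :: "real \<Rightarrow> real"
  assumes "rich_prob_space M"
    and "0 < T"
    and "continuous_P2 W0"
    and "continuous_P2 (\<lambda>(x, u) \<mu>. F x \<mu> u)"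
    and "continuous_P2 (\<lambda>(x, u) \<mu>. G x \<mu> u)"
    and "\<forall>x u. \<forall>\<mu>\<in>P2. norm (W0 x \<mu>) + norm (F x \<mu> u) + norm (G x \<mu> u)
           \<le> C1 * (1 + norm x + norm u + sqrt (E2 \<mu>))"
    and "0 < \<alpha>" and "0 < a0"
    and "\<forall>X\<in>L2_rv M. \<forall>Y\<in>L2_rv M.
           L2_inner M (lift1 M W0 X - lift1 M W0 Y) (X - Y)
             \<ge> a0 * (L2_norm M (lift1 M W0 X - lift1 M W0 Y))\<^sup>2"
    and "\<forall>X\<in>L2_rv M. \<forall>Y\<in>L2_rv M. \<forall>U\<in>L2_rv M. \<forall>V\<in>L2_rv M.
           L2_inner M (lift2 M G X U - lift2 M G Y V) (X - Y)
             + L2_inner M (lift2 M F X U - lift2 M F Y V) (U - V)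
             \<ge> \<alpha> * (L2_norm M (X - Y))\<^sup>2"
    and "0 < \<gamma>" and "\<gamma> \<le> 1"
    and "modulus_of_continuity w"
    and "\<forall>X\<in>L2_rv M. \<forall>Y\<in>L2_rv M. \<forall>U\<in>L2_rv M. \<forall>V\<in>L2_rv M.
           L2_inner M (lift2 M G X U - lift2 M G Y V) (U - V)
             \<le> C2 * ((L2_norm_exp M \<gamma> (X - Y))\<^sup>2 + (L2_norm M (U - V))\<^sup>2)"
    and "\<forall>X\<in>L2_rv M. \<forall>Y\<in>L2_rv M. \<forall>U\<in>L2_rv M. \<forall>V\<in>L2_rv M.
           L2_inner M (lift2 M F X U - lift2 M F Y V) (X - Y)
             \<ge> - C2 * ((L2_norm_exp M \<gamma> (X - Y))\<^sup>2 + (L2_norm_exp M \<gamma> (U - V))\<^sup>2)"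
    and "\<forall>x u. \<forall>\<mu>\<in>P2. \<forall>\<nu>\<in>P2.
           norm (F x \<mu> u - F x \<nu> u) + norm (G x \<mu> u - G x \<nu> u) + norm (W0 x \<mu> - W0 x \<nu>)
             \<le> w (W2 \<mu> \<nu>)"
  shows "\<exists>C::real. \<forall>\<sigma>\<ge>0. \<forall>Ft B X0 Y0 X Wx Zx Y Wy Zy.
     filtered_space M Ft \<longrightarrow> brownian_motion M Ft B \<longrightarrow>
     X0 \<in> L2_rv M \<longrightarrow> X0 \<in> borel_measurable (Ft 0) \<longrightarrow>
     Y0 \<in> L2_rv M \<longrightarrow> Y0 \<in> borel_measurable (Ft 0) \<longrightarrow>
     strong_solution M Ft B T \<sigma> W0 F G X0 X Wx Zx \<longrightarrow>
     strong_solution M Ft B T \<sigma> W0 F G Y0 Y Wy Zy \<longrightarrow>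
     (SUP t\<in>{0..T}. ereal (L2_norm M (Wx t - Wy t)))
       \<le> ereal (C * L2_norm_exp M (\<gamma> / (2 - \<gamma>)) (X0 - Y0)) \<and>
     (SUP t\<in>{0..T}. ereal (L2_norm M (X t - Y t)))
       \<le> ereal (C * L2_norm_exp M (\<gamma>\<^sup>2 / (2 - \<gamma>)) (X0 - Y0))"
proof -
  \<comment> \<open>The estimates multiply the bounds by this constant, so it has to be nonnegative.\<close>
  define c where "c = \<bar>C2\<bar>"
  define E where "E = 2 * exp (2 * (2 * c + 1) * T)"
  have c: "0 \<le> c" "C2 \<le> c" and E0: "0 \<le> E" by (simp_all add: c_def E_def)
  obtain C where C0: "0 \<le> C" and
    C: "\<And>p0 q0 A H Q. 0 \<le> p0 \<Longrightarrow> 0 \<le> q0 \<Longrightarrow> 0 \<le> A \<Longrightarrow> 0 \<le> H \<Longrightarrow>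
      a0 * H + \<alpha> * A \<le> p0 * q0 \<Longrightarrow> Q = E * (H + 2 * c * (A + (1 + T) * A powr \<gamma>)) \<Longrightarrow> q0\<^sup>2 \<le> Q \<Longrightarrow>
      Q \<le> (C * max p0 (p0 powr (\<gamma> / (2 - \<gamma>))))\<^sup>2 \<and>
      p0\<^sup>2 + 2 * c * (A + (1 + T) * A powr \<gamma> + T * (Q + Q powr \<gamma>))
        \<le> (C * max p0 (p0 powr (\<gamma>\<^sup>2 / (2 - \<gamma>))))\<^sup>2"
    using closing_estimate[OF assms(8,7) c(1) assms(2) E0 assms(11,12)] by (elim exE conjE) simp
  have prob: "prob_space M" using assms(1) by (simp add: rich_prob_space_def)
  note growth = assms(6)[rule_format]
  show ?thesis
  proof (intro exI[of _ C] allI impI)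
    fix \<sigma> :: real and Ft and B :: "real \<Rightarrow> 'a \<Rightarrow> real^'d" and X0 Y0 X Wx Zx Y Wy Zy
    assume filt: "filtered_space M Ft" and bm: "brownian_motion M Ft B"
      and X0: "X0 \<in> L2_rv M" "X0 \<in> borel_measurable (Ft 0)"
      and Y0: "Y0 \<in> L2_rv M" "Y0 \<in> borel_measurable (Ft 0)"
      and sx: "strong_solution M Ft B T \<sigma> W0 F G X0 X Wx Zx"
      and sy: "strong_solution M Ft B T \<sigma> W0 F G Y0 Y Wy Zy"
    interpret prob_space M by (rule prob)
    interpret driven_system M T Ft B W0 F G C1 \<sigma>
    proof
      show "0 < T" "filtered_space M Ft" "brownian_motion M Ft B" by fact+
      show "continuous_P2 W0" "continuous_P2 (\<lambda>(x, v) \<mu>. F x \<mu> v)" "continuous_P2 (\<lambda>(x, v) \<mu>. G x \<mu> v)"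
        by fact+
      fix x v and \<mu> :: "(real^'d) measure" assume \<mu>: "\<mu> \<in> P2"
      show "norm (W0 x \<mu>) \<le> C1 * (1 + norm x + sqrt (E2 \<mu>))"
        using growth[OF \<mu>, of x 0] norm_ge_zero[of "F x \<mu> 0"] norm_ge_zero[of "G x \<mu> 0"]
        by (simp del: norm_ge_zero)
      show "norm (F x \<mu> v) \<le> C1 * (1 + norm x + norm v + sqrt (E2 \<mu>))"
        "norm (G x \<mu> v) \<le> C1 * (1 + norm x + norm v + sqrt (E2 \<mu>))"
        using growth[OF \<mu>, of x v] norm_ge_zero[of "W0 x \<mu>"] norm_ge_zero[of "F x \<mu> v"]
          norm_ge_zero[of "G x \<mu> v"] by linarith+
    qed
    have sol: "solution X0 X Wx Zx" "solution Y0 Y Wy Zy" using sx sy by (simp_all add: solution_def)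
    interpret coupled_system M T "\<lambda>t. X t - Y t" "\<lambda>t. Wx t - Wy t"
      "\<lambda>t. lift2 M F (X t) (Wx t) - lift2 M F (Y t) (Wy t)"
      "\<lambda>t. lift2 M G (X t) (Wx t) - lift2 M G (Y t) (Wy t)"
      "X0 - Y0" "lift1 M W0 (X T) - lift1 M W0 (Y T)"
      by (rule difference_coupled_system[OF sol X0 Y0])
    note L2 = processD(2)[OF solution_processes(1)[OF sol(1)]] processD(2)[OF solution_processes(1)[OF sol(2)]]
      processD(2)[OF solution_processes(2)[OF sol(1)]] processD(2)[OF solution_processes(2)[OF sol(2)]]
    have T: "T \<in> {0..T}" "0 \<in> {0..T}" using assms(2) by auto
    have m1: "a0 * (L2_norm M (lift1 M W0 (X T) - lift1 M W0 (Y T)))\<^sup>2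
        \<le> L2_inner M (lift1 M W0 (X T) - lift1 M W0 (Y T)) (X T - Y T)"
      by (rule assms(9)[rule_format, OF L2(1)[OF T(1)] L2(2)[OF T(1)]])
    have m2: "\<alpha> * (L2_norm M (X s - Y s))\<^sup>2
        \<le> L2_inner M (lift2 M G (X s) (Wx s) - lift2 M G (Y s) (Wy s)) (X s - Y s)
          + L2_inner M (lift2 M F (X s) (Wx s) - lift2 M F (Y s) (Wy s)) (Wx s - Wy s)"
      if "s \<in> {0..T}" for s
      by (rule assms(10)[rule_format, OF L2[OF that]])
    have m3: "L2_inner M (lift2 M G (X s) (Wx s) - lift2 M G (Y s) (Wy s)) (Wx s - Wy s)
        \<le> c * ((L2_norm_exp M \<gamma> (X s - Y s))\<^sup>2 + (L2_norm M (Wx s - Wy s))\<^sup>2)"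
      if "s \<in> {0..T}" for s
      by (rule order_trans[OF assms(14)[rule_format, OF L2[OF that]]])
         (use c in \<open>auto intro!: mult_right_mono\<close>)
    have m4: "- c * ((L2_norm_exp M \<gamma> (X s - Y s))\<^sup>2 + (L2_norm_exp M \<gamma> (Wx s - Wy s))\<^sup>2)
        \<le> L2_inner M (lift2 M F (X s) (Wx s) - lift2 M F (Y s) (Wy s)) (X s - Y s)"
      if "s \<in> {0..T}" for s
      by (rule order_trans[OF _ assms(15)[rule_format, OF L2[OF that]]])
         (use c in \<open>auto intro!: mult_right_mono\<close>)
    define p0 where "p0 = L2_norm M (X0 - Y0)"
    define q0 where "q0 = L2_norm M (Wx 0 - Wy 0)"
    define A where "A = (\<integral>s. (L2_norm M (X s - Y s))\<^sup>2 \<partial>\<L>)"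
    define H where "H = (L2_norm M (lift1 M W0 (X T) - lift1 M W0 (Y T)))\<^sup>2"
    define Q where "Q = E * (H + 2 * c * (A + (1 + T) * A powr \<gamma>))"
    have energy: "a0 * H + \<alpha> * A \<le> p0 * q0"
      unfolding H_def A_def p0_def q0_def
      by (rule stability(1)[OF c(1) assms(11,12) m1 m2 m3 m4])
    have W_le: "(L2_norm M (Wx t - Wy t))\<^sup>2 \<le> Q" if "t \<in> {0..T}" for t
      unfolding Q_def E_def H_def A_def
      by (rule stability(2)[OF c(1) assms(11,12) m1 m2 m3 m4]; (assumption | rule that))
    have X_le: "(L2_norm M (X t - Y t))\<^sup>2
        \<le> p0\<^sup>2 + 2 * c * (A + (1 + T) * A powr \<gamma> + T * (Q + Q powr \<gamma>))" if "t \<in> {0..T}" for t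
      unfolding p0_def A_def
      by (rule stability(3)[OF c(1) assms(11,12) m1 m2 m3 m4]; (assumption | rule that | rule W_le, assumption))
    have nonneg: "0 \<le> p0" "0 \<le> q0" "0 \<le> A" "0 \<le> H" by (simp_all add: p0_def q0_def A_def H_def)
    have "q0\<^sup>2 \<le> Q" unfolding q0_def by (rule W_le[OF T(2)])
    from C[OF nonneg energy Q_def this]
    have CQ: "Q \<le> (C * max p0 (p0 powr (\<gamma> / (2 - \<gamma>))))\<^sup>2"
      "p0\<^sup>2 + 2 * c * (A + (1 + T) * A powr \<gamma> + T * (Q + Q powr \<gamma>))
        \<le> (C * max p0 (p0 powr (\<gamma>\<^sup>2 / (2 - \<gamma>))))\<^sup>2" by blast+
    have "L2_norm M (Wx t - Wy t) \<le> C * L2_norm_exp M (\<gamma> / (2 - \<gamma>)) (X0 - Y0)" if "t \<in> {0..T}" for t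
      unfolding L2_norm_exp_def p0_def[symmetric]
      by (rule power2_le_imp_le[OF order_trans[OF W_le[OF that] CQ(1)]])
         (use C0 nonneg in \<open>auto intro!: mult_nonneg_nonneg simp: le_max_iff_disj\<close>)
    moreover have "L2_norm M (X t - Y t) \<le> C * L2_norm_exp M (\<gamma>\<^sup>2 / (2 - \<gamma>)) (X0 - Y0)"
      if "t \<in> {0..T}" for t
      unfolding L2_norm_exp_def p0_def[symmetric]
      by (rule power2_le_imp_le[OF order_trans[OF X_le[OF that] CQ(2)]])
         (use C0 nonneg in \<open>auto intro!: mult_nonneg_nonneg simp: le_max_iff_disj\<close>)
    ultimately show "(SUP t\<in>{0..T}. ereal (L2_norm M (Wx t - Wy t)))
        \<le> ereal (C * L2_norm_exp M (\<gamma> / (2 - \<gamma>)) (X0 - Y0)) \<and>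
      (SUP t\<in>{0..T}. ereal (L2_norm M (X t - Y t)))
        \<le> ereal (C * L2_norm_exp M (\<gamma>\<^sup>2 / (2 - \<gamma>)) (X0 - Y0))"
      by (auto intro!: SUP_least)
  qed
qed

end
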